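(* Let $G$ be a graph with $n$ vertices, let $\prec$ be a linear ordering of the vertices of $G$, and let $t\ge 1$ be an integer. Let $l=2\ell(5t,5tn)$, $b=\omega^2_l(G)\,l$, $m=2\ell(5t,20t)$, $r=\lceil\log_{9/8}(20t/3)\rceil$, and $n'=5bt\,\mathrm{wcol}_m^\prec(G)$. Then $$\eta(G,t)\le r\,\eta_{\le n'}\bigl(G^{[\prec,m]},5rt\bigr).$$
   Context: For integers $t,b\ge 1$, $\ell(t,b)$ is the minimum integer $\ell$ such that $(1+1/t)^\ell>b$. A depth-$l$ minor of $G$ is a graph obtained from a subgraph of $G$ by contracting pairwise vertex-disjoint connected subgraphs each of radius at most $l$; $\omega_l(G)$ is the largest number of vertices of a clique that appears in $G$ as a depth-$l$ minor. For a linear ordering $\prec$ of $V(G)$, a vertex $v$ and integer $m\ge0$, $L^\prec_m(v)$ is the set of vertices $u$ such that there is a path $P$ in $G$ from $v$ to $u$ with at most $m$ edges and $u\preceq x$ for all $x\in V(P)$; $\mathrm{wcol}^\prec_m(G)=\max_v|L^\prec_m(v)|$; $G^{[\prec,m]}$ is the graph with vertex set $V(G)$ and edges $uv$ for all $v$ and $u\in L^\prec_m(v)$, $u\ne v$. Weight and cost assignments are functions $V(H)\to\mathbb{R}_0^+$, extended additively to sets, with $f(H)=f(V(H))$. For a weight assignment $w$, a $w$-balanced separator in $H$ is a set $C\subseteq V(H)$ such that every component $K$ of $H-C$ satisfies $w(K)\le\tfrac{2}{3}w(H)$. For a cost assignment $\rho$, a set $C$ is $(\rho/t)$-cheap with $q$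 outliers if there is $C'\subseteq C$ with $|C'|\le q$ and $\rho(C\setminus C')\le\rho(H)/t$. $\eta(H,t)$ is the minimum integer $q$ such that for every weight assignment $w$ and cost assignment $\rho$ for $H$ there is a $w$-balanced separator in $H$ which is $(\rho/t)$-cheap with $q$ outliers. For a positive integer $n'$, $\eta_{\le n'}(H,t)$ is the maximum of $\eta(H',t)$ over all subgraphs $H'$ of $H$ with at most $n'$ vertices. *)

theory Defs
  imports Complex_Main "Graph_Theory.Graph_Theory"
begin

text \<open>
  A finite simple undirected graph is a \<open>pair_graph\<close>: a finite, loop-free, symmetric digraph
  without parallel arcs.  An edge \<open>uv\<close> is the pair of arcs \<open>(u, v)\<close>, \<open>(v, u)\<close>.
\<close>

text \<open>The library's \<open>subgraph\<close> alone would also admit non-symmetric arc sets.\<close>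

definition simple_subgraph :: "'a pair_pre_digraph \<Rightarrow> 'a pair_pre_digraph \<Rightarrow> bool" where
  "simple_subgraph H G \<longleftrightarrow> pair_graph H \<and> subgraph (with_proj H) (with_proj G)"

text \<open>For \<open>t, b \<ge> 1\<close> every integer exponent that qualifies is positive, so the minimum may be
  taken over the naturals.\<close>

definition ell :: "nat \<Rightarrow> nat \<Rightarrow> nat" where
  "ell t b = (LEAST l. (1 + 1 / real t) ^ l > real b)"


subsection \<open>Bounded-depth minors\<close>

definition gdist :: "'a pair_pre_digraph \<Rightarrow> 'a \<Rightarrow> 'a \<Rightarrow> nat" where
  "gdist G u v = (LEAST k. \<exists>p. pre_digraph.apath (with_proj G) u p v \<and> length p = k)"

text \<open>Meaningful for finite connected (in particular nonempty) graphs only.\<close>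

definition radius :: "'a pair_pre_digraph \<Rightarrow> nat" where
  "radius G = Min ((\<lambda>c. Max (gdist G c ` pverts G)) ` pverts G)"

text \<open>Contraction of a family \<open>F\<close> of vertex-disjoint subgraphs of \<open>G\<close>.  A vertex of the result is
  the set of the vertices of \<open>G\<close> that are merged into it.\<close>

definition contract :: "'a pair_pre_digraph \<Rightarrow> 'a pair_pre_digraph set \<Rightarrow> 'a set pair_pre_digraph" where
  "contract G F =
    (let V = pverts ` F \<union> {{v} | v. v \<in> pverts G - (\<Union>K\<in>F. pverts K)}
     in \<lparr>pverts = V,
         parcs = {(A, B). A \<in> V \<and> B \<in> V \<and> A \<noteq> B \<and> (\<exists>a\<in>A. \<exists>b\<in>B. (a, b) \<in> parcs G)}\<rparr>)"

definition depth_minors :: "nat \<Rightarrow> 'a pair_pre_digraph \<Rightarrow> 'a set pair_pre_digraph set" where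
  "depth_minors l G = {contract G' F | G' F.
     simple_subgraph G' G \<and>
     (\<forall>K\<in>F. simple_subgraph K G' \<and> Digraph_Component.connected (with_proj K) \<and> radius K \<le> l) \<and>
     (\<forall>K\<in>F. \<forall>K'\<in>F. K \<noteq> K' \<longrightarrow> pverts K \<inter> pverts K' = {})}"

definition omega :: "nat \<Rightarrow> 'a pair_pre_digraph \<Rightarrow> nat" where
  "omega l G = Max {k. \<exists>M\<in>depth_minors l G. complete_digraph k (with_proj M)}"


subsection \<open>Weak colouring numbers\<close>

text \<open>Below, \<open>r\<close> is a (reflexive) linear order on the vertices, with \<open>(u, x) \<in> r\<close> for \<open>u \<preceq> x\<close>.\<close>

definition wreach :: "'a pair_pre_digraph \<Rightarrow> 'a rel \<Rightarrow> nat \<Rightarrow> 'a \<Rightarrow> 'a set" where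
  "wreach G r m v = {u. \<exists>p. pre_digraph.apath (with_proj G) v p u \<and> length p \<le> m \<and>
     (\<forall>x\<in>set (pawalk_verts v p). (u, x) \<in> r)}"

definition wcol :: "'a pair_pre_digraph \<Rightarrow> 'a rel \<Rightarrow> nat \<Rightarrow> nat" where
  "wcol G r m = Max ((\<lambda>v. card (wreach G r m v)) ` pverts G)"

definition wreach_graph :: "'a pair_pre_digraph \<Rightarrow> 'a rel \<Rightarrow> nat \<Rightarrow> 'a pair_pre_digraph" where
  "wreach_graph G r m = \<lparr>pverts = pverts G,
     parcs = {(u, v). u \<in> pverts G \<and> v \<in> pverts G \<and> u \<noteq> v \<and>
                      (u \<in> wreach G r m v \<or> v \<in> wreach G r m u)}\<rparr>"


subsection \<open>Balanced separators\<close>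

definition assignment :: "'a pair_pre_digraph \<Rightarrow> ('a \<Rightarrow> real) \<Rightarrow> bool" where
  "assignment H f \<longleftrightarrow> (\<forall>v\<in>pverts H. 0 \<le> f v)"

text \<open>The components of \<open>H - C\<close> are its maximal connected subgraphs.\<close>

definition balanced_separator :: "'a pair_pre_digraph \<Rightarrow> ('a \<Rightarrow> real) \<Rightarrow> 'a set \<Rightarrow> bool" where
  "balanced_separator H w C \<longleftrightarrow> C \<subseteq> pverts H \<and>
     (\<forall>K. pre_digraph.max_subgraph (induce_subgraph (with_proj H) (pverts H - C))
            Digraph_Component.connected K \<longrightarrow>
          sum w (verts K) \<le> 2 / 3 * sum w (pverts H))"

definition cheap_with_outliers ::
    "'a pair_pre_digraph \<Rightarrow> ('a \<Rightarrow> real) \<Rightarrow> nat \<Rightarrow> nat \<Rightarrow> 'a set \<Rightarrow> bool" where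
  "cheap_with_outliers H \<rho> t q C \<longleftrightarrow>
     (\<exists>C'\<subseteq>C. card C' \<le> q \<and> sum \<rho> (C - C') \<le> sum \<rho> (pverts H) / real t)"

definition eta :: "'a pair_pre_digraph \<Rightarrow> nat \<Rightarrow> nat" where
  "eta H t = (LEAST q. \<forall>w \<rho>. assignment H w \<and> assignment H \<rho> \<longrightarrow>
     (\<exists>C. balanced_separator H w C \<and> cheap_with_outliers H \<rho> t q C))"

definition eta_le :: "nat \<Rightarrow> 'a pair_pre_digraph \<Rightarrow> nat \<Rightarrow> nat" where
  "eta_le n' H t = Max {eta H' t | H'. simple_subgraph H' H \<and> card (pverts H') \<le> n'}"

end

theory Submission
  imports Defs
begin

text \<open>
  Let \<open>R\<close> be the total cost.  At most \<open>5bt\<close> vertices are expensive, that is, cost more than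
  \<open>R / (5bt)\<close>; call their set \<open>X\<close>.  A Plotkin-Rao-Smith argument separates a graph by deleting cheap
  layers of breadth-first search and the at most \<open>b\<close> vertices of a shallow clique minor, which are
  affordable as long as they avoid \<open>X\<close>.

  To get rid of \<open>X\<close>, consider the heavy part \<open>K\<close>, the vertices weakly \<open>m\<close>-reachable from \<open>X \<inter> K\<close>, and
  a separator \<open>A\<close> of the subgraph of the weak reachability graph they induce, balanced for the cost restricted to
  \<open>X \<inter> K\<close>.  The least vertex of a walk of length at most \<open>m\<close> is weakly reachable from both ends, hence
  expensive vertices in different components are at distance more than \<open>m\<close> in \<open>G - A\<close>.  So balls
  around two groups of components can be grown until their boundaries are cheap, and the lighter ball
  is cut off.  Each round shrinks the cost of \<open>X \<inter> K\<close> by a constant factor; after \<open>r\<close> rounds it is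
  at most \<open>R / (5t)\<close>, so that \<open>X \<inter> K\<close> can be deleted.  The discarded balls of all rounds and of the
  final Plotkin-Rao-Smith step are disjoint, hence all cheap layers together cost at most \<open>R / (5t)\<close>.
\<close>

subsection \<open>Sparse cuts in weighted graphs\<close>

text \<open>Elements are added one by one. Just before the sum reaches \<theta> it is below
  \<theta>, and the next element adds less than \<theta>.\<close>

lemma subfamily_sum_between:
  fixes f :: "'b \<Rightarrow> real"
  assumes "finite Q" "0 < \<theta>" "\<forall>q\<in>Q. f q < \<theta>" "\<theta> \<le> sum f Q"
  shows "\<exists>Y\<subseteq>Q. \<theta> \<le> sum f Y \<and> sum f Y < 2 * \<theta>"
  using assms
proof (induction Q rule: finite_induct)
  case empty
  then show ?case by simp
next
  case (insert a F)
  show ?case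
  proof (cases "\<theta> \<le> sum f F")
    case True
    then show ?thesis using insert by (meson insertI2 subset_insertI2)
  next
    case False
    then show ?thesis using insert by (intro exI[of _ "insert a F"]) auto
  qed
qed

text \<open>A class of value at least \<open>2/9 * x + u/9\<close> is one part by itself, since it
  takes away at most \<open>2/3 * x\<close>. If there is none, a greedy part of value below twice
  this threshold leaves more than \<open>4/9 * x - u/9\<close>, which is enough because
  \<open>u < x\<close>.\<close>

lemma balanced_bipartition:
  fixes f :: "'b \<Rightarrow> real"
  assumes "finite Q" "\<forall>q\<in>Q. 0 \<le> f q \<and> f q \<le> 2/3 * x"
    and "sum f Q > 8/9 * x + u/9" "0 < u" "4 * u < x"
  shows "\<exists>Y\<subseteq>Q. sum f Y \<ge> 2/9 * x + u/9 \<and> sum f (Q - Y) \<ge> 2/9 * x + u/9"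
proof (cases "\<exists>q\<in>Q. f q \<ge> 2/9 * x + u/9")
  case True
  then obtain q where q: "q \<in> Q" "f q \<ge> 2/9 * x + u/9" by auto
  have "sum f (Q - {q}) = sum f Q - f q"
    using assms(1) q by (simp add: sum_diff1)
  moreover have "f q \<le> 2/3 * x" using assms q by auto
  ultimately have "sum f (Q - {q}) \<ge> 2/9 * x + u/9" using assms by auto
  then show ?thesis using q by (intro exI[of _ "{q}"]) auto
next
  case False
  have "2/9 * x + u/9 \<le> sum f Q" using assms by auto
  then obtain Y where Y: "Y \<subseteq> Q" "2/9 * x + u/9 \<le> sum f Y" "sum f Y < 2 * (2/9 * x + u/9)"
    using subfamily_sum_between[of Q "2/9 * x + u/9" f] assms False by force
  have "sum f (Q - Y) = sum f Q - sum f Y"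
    using assms(1) Y by (simp add: sum_diff)
  then show ?thesis using Y assms by (intro exI[of _ Y]) auto
qed

section \<open>Clique minors of bounded depth as families of bags\<close>

text \<open>These are the bags of a clique minor of depth \<open>l\<close>, with \<open>c\<close> as
  the centre of a bag. Relation powers stand in for paths, and the centre forces bags to be
  nonempty.\<close>

definition shallow_clique :: "'a rel \<Rightarrow> nat \<Rightarrow> 'a set set \<Rightarrow> bool" where
  "shallow_clique E l \<B> \<longleftrightarrow>
     (\<forall>B\<in>\<B>. \<exists>c\<in>B. \<forall>x\<in>B. \<exists>k\<le>l. (c, x) \<in> (Restr E B) ^^ k) \<and>
     (\<forall>A\<in>\<B>. \<forall>B\<in>\<B>. A \<noteq> B \<longrightarrow> A \<inter> B = {} \<and> (\<exists>a\<in>A. \<exists>b\<in>B. (a, b) \<in> E))"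

lemma shallow_clique_subset: "shallow_clique E l \<B> \<Longrightarrow> \<A> \<subseteq> \<B> \<Longrightarrow> shallow_clique E l \<A>"
  unfolding shallow_clique_def by blast

lemma relpow_sym: "sym R \<Longrightarrow> (x, y) \<in> R ^^ k \<Longrightarrow> (y, x) \<in> R ^^ k"
proof (induction k arbitrary: x y)
  case (Suc k)
  from Suc.prems(2) obtain z where "(x, z) \<in> R ^^ k" "(z, y) \<in> R" by auto
  then have "(y, z) \<in> R" "(z, x) \<in> R ^^ k" using Suc by (auto dest: symD)
  then show ?case by (rule relpow_Suc_I2)
qed auto

section \<open>Weighted graphs and separation\<close>

locale weighted_graph =
  fixes V :: "'a set" and E :: "'a rel" and w \<rho> :: "'a \<Rightarrow> real"
  assumes finite_V: "finite V" and E_subset: "E \<subseteq> V \<times> V" and sym_E: "sym E"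
    and w_nonneg: "v \<in> V \<Longrightarrow> 0 \<le> w v" and rho_nonneg: "v \<in> V \<Longrightarrow> 0 \<le> \<rho> v"
begin

text \<open>For symmetric \<open>E\<close> this is connectedness, phrased as the absence of a proper
  nonempty closed part; the empty set counts as linked.\<close>

definition linked :: "'a set \<Rightarrow> bool" where
  "linked U \<longleftrightarrow> (\<forall>P\<subseteq>U. P \<noteq> {} \<and> E `` P \<inter> U \<subseteq> P \<longrightarrow> P = U)"

text \<open>Ranging over all connected sets instead of the components alone is equivalent, as
  weights are nonnegative, and makes the notion visibly monotone in \<open>C\<close>.\<close>

definition separates :: "'a set \<Rightarrow> bool" where
  "separates C \<longleftrightarrow> (\<forall>U\<subseteq>V - C. linked U \<longrightarrow> sum w U \<le> 2/3 * sum w V)"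

lemma finite_sub: "A \<subseteq> V \<Longrightarrow> finite A"
  using finite_V finite_subset by blast

lemma sum_rho_mono: "A \<subseteq> B \<Longrightarrow> B \<subseteq> V \<Longrightarrow> sum \<rho> A \<le> sum \<rho> B"
  by (rule sum_mono2) (auto intro: finite_sub rho_nonneg)

lemma sum_w_mono: "A \<subseteq> B \<Longrightarrow> B \<subseteq> V \<Longrightarrow> sum w A \<le> sum w B"
  by (rule sum_mono2) (auto intro: finite_sub w_nonneg)

lemma sum_rho_nonneg: "A \<subseteq> V \<Longrightarrow> 0 \<le> sum \<rho> A"
  by (rule sum_nonneg) (auto intro: rho_nonneg)

lemma sum_w_nonneg: "A \<subseteq> V \<Longrightarrow> 0 \<le> sum w A"
  by (rule sum_nonneg) (auto intro: w_nonneg)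

lemma sum_rho_Un_le: "A \<subseteq> V \<Longrightarrow> B \<subseteq> V \<Longrightarrow> sum \<rho> (A \<union> B) \<le> sum \<rho> A + sum \<rho> B"
  using sum.union_inter[of A B \<rho>] sum_rho_nonneg[of "A \<inter> B"] finite_sub[of A] finite_sub[of B]
  by (simp add: le_infI1)

lemma sum_w_disjoint_le: "A \<subseteq> V \<Longrightarrow> B \<subseteq> V \<Longrightarrow> A \<inter> B = {} \<Longrightarrow> sum w A + sum w B \<le> sum w V"
  using sum_w_mono[of "A \<union> B" V] by (simp add: sum.union_disjoint finite_sub)

lemma separates_mono: "separates C \<Longrightarrow> C \<subseteq> D \<Longrightarrow> separates D"
  unfolding separates_def by blast

lemma linked_cases:
  assumes "linked U" "P \<subseteq> U" "E `` P \<inter> U \<subseteq> P"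
  shows "P = {} \<or> U = P"
  using assms unfolding linked_def by blast

text \<open>A connected set that avoids \<open>C\<close> can neither leave \<open>K\<close> nor
  cross between \<open>P\<close> and \<open>Q\<close>. So it lies in \<open>P\<close>, in
  \<open>Q\<close> or outside \<open>K\<close>.\<close>

lemma separatesI:
  assumes "K \<subseteq> V" "E `` K \<subseteq> K \<union> C" "P \<subseteq> K" "Q \<subseteq> K" "K \<subseteq> P \<union> Q \<union> C" "E `` P \<inter> Q = {}"
    and "sum w P \<le> 2/3 * sum w V" "sum w Q \<le> 2/3 * sum w V" "sum w (V - K) \<le> 2/3 * sum w V"
  shows "separates C"
  unfolding separates_def
proof (intro allI impI)
  fix U assume U: "U \<subseteq> V - C" "linked U"
  have QP: "E `` Q \<inter> P = {}" using assms(6) sym_E by (auto dest: symD)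
  have "E `` (U \<inter> P) \<inter> U \<subseteq> U \<inter> P"
    using assms U by blast
  with linked_cases[OF U(2), of "U \<inter> P"] have P: "U \<inter> P = {} \<or> U \<subseteq> P" by auto
  have "E `` (U \<inter> Q) \<inter> U \<subseteq> U \<inter> Q"
    using assms QP U by blast
  with linked_cases[OF U(2), of "U \<inter> Q"] have Q: "U \<inter> Q = {} \<or> U \<subseteq> Q" by auto
  consider "U \<subseteq> P" | "U \<subseteq> Q" | "U \<subseteq> V - K" using P Q U assms(5) by blast
  then show "sum w U \<le> 2/3 * sum w V"
  proof cases
    case 1 then show ?thesis using assms sum_w_mono[of U P] by force
  next
    case 2 then show ?thesis using assms sum_w_mono[of U Q] by force
  next
    case 3 then show ?thesis using assms sum_w_mono[of U "V - K"] by force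
  qed
qed

section \<open>Ball growing inside a vertex set\<close>

primrec nbhd :: "'a set \<Rightarrow> 'a set \<Rightarrow> nat \<Rightarrow> 'a set" where
  "nbhd K Y 0 = Y"
| "nbhd K Y (Suc i) = nbhd K Y i \<union> (E `` nbhd K Y i \<inter> K)"

lemma nbhd_subset: "Y \<subseteq> K \<Longrightarrow> nbhd K Y i \<subseteq> K"
  by (induction i) auto

lemma nbhd_mono: "i \<le> j \<Longrightarrow> nbhd K Y i \<subseteq> nbhd K Y j"
  by (induction rule: dec_induct) auto

lemma nbhd_superset: "Y \<subseteq> nbhd K Y i"
  using nbhd_mono[of 0 i] by simp

lemma nbhd_walk:
  assumes "Y \<subseteq> K" "x \<in> nbhd K Y i"
  shows "\<exists>y\<in>Y. \<exists>k\<le>i. (y, x) \<in> (Restr E K) ^^ k"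
  using assms(2)
proof (induction i arbitrary: x)
  case 0
  then show ?case by force
next
  case (Suc i)
  show ?case
  proof (cases "x \<in> nbhd K Y i")
    case True
    then show ?thesis using Suc.IH[OF True] le_SucI by blast
  next
    case False
    then obtain z where z: "z \<in> nbhd K Y i" "(z, x) \<in> E" "x \<in> K" using Suc by auto
    obtain y k where "y \<in> Y" "k \<le> i" "(y, z) \<in> (Restr E K) ^^ k" using Suc.IH[OF z(1)] by auto
    moreover have "(z, x) \<in> Restr E K" using z nbhd_subset[OF assms(1)] by auto
    ultimately have "(y, x) \<in> (Restr E K) ^^ Suc k" "Suc k \<le> Suc i" by auto
    then show ?thesis using \<open>y \<in> Y\<close> by blast
  qed
qed

text \<open>Otherwise each of the first \<open>L\<close> layers would multiply the cost by at least
  \<open>1 + 1/T\<close>, and the ball of radius \<open>L\<close> would cost more than all of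
  \<open>V\<close>.\<close>

lemma cheap_layer:
  assumes "Y \<subseteq> K" "K \<subseteq> V" "0 < T" "(1 + 1/T) ^ L * sum \<rho> Y > sum \<rho> V"
  shows "\<exists>i<L. sum \<rho> (nbhd K Y (Suc i) - nbhd K Y i) \<le> sum \<rho> (nbhd K Y i) / T"
proof (rule ccontr)
  assume "\<not> ?thesis"
  then have H: "sum \<rho> (nbhd K Y (Suc i) - nbhd K Y i) > sum \<rho> (nbhd K Y i) / T" if "i < L" for i
    using that by force
  have sub: "nbhd K Y i \<subseteq> V" for i using nbhd_subset assms by blast
  have "j \<le> L \<Longrightarrow> (1 + 1/T) ^ j * sum \<rho> Y \<le> sum \<rho> (nbhd K Y j)" for j
  proof (induction j)
    case (Suc j)
    have "(1 + 1/T) ^ Suc j * sum \<rho> Y \<le> (1 + 1/T) * sum \<rho> (nbhd K Y j)"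
      using Suc assms(3) by (auto simp: mult.assoc intro: mult_left_mono)
    also have "\<dots> = sum \<rho> (nbhd K Y j) + sum \<rho> (nbhd K Y j) / T"
      by (simp add: field_simps)
    also have "\<dots> \<le> sum \<rho> (nbhd K Y j) + sum \<rho> (nbhd K Y (Suc j) - nbhd K Y j)"
      using H[of j] Suc by linarith
    also have "\<dots> = sum \<rho> (nbhd K Y (Suc j))"
      using sum.subset_diff[of "nbhd K Y j" "nbhd K Y (Suc j)" \<rho>] sub[of "Suc j"] finite_sub
      by (simp del: nbhd.simps add: nbhd_mono)
    finally show ?case .
  qed simp
  from this[of L] have "(1 + 1/T) ^ L * sum \<rho> Y \<le> sum \<rho> V"
    using sum_rho_mono[OF sub[of L]] by simp
  then show False using assms by simp
qed

text \<open>Balls around both sets are grown inside \<open>K\<close> up to a cheap layer. They are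
  disjoint, so the lighter one has at most half of the weight; its next layer is
  \<open>S\<close>.\<close>

lemma sparse_cut:
  assumes "K \<subseteq> V" "Y\<^sub>1 \<subseteq> K" "Y\<^sub>2 \<subseteq> K" "0 < T"
    and grow: "(1 + 1/T) ^ L * sum \<rho> Y\<^sub>1 > sum \<rho> V" "(1 + 1/T) ^ L * sum \<rho> Y\<^sub>2 > sum \<rho> V"
    and far: "\<And>x y k. x \<in> Y\<^sub>1 \<Longrightarrow> y \<in> Y\<^sub>2 \<Longrightarrow> k + 2 \<le> 2 * L \<Longrightarrow> (x, y) \<notin> (Restr E K) ^^ k"
  obtains B S where "B \<subseteq> K" "S \<subseteq> K" "B \<inter> S = {}" "E `` B \<inter> K \<subseteq> B \<union> S"
    "sum \<rho> S \<le> sum \<rho> B / T" "2 * sum w B \<le> sum w V" "Y\<^sub>1 \<subseteq> B \<or> Y\<^sub>2 \<subseteq> B"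
proof -
  obtain i where i: "i < L" "sum \<rho> (nbhd K Y\<^sub>1 (Suc i) - nbhd K Y\<^sub>1 i) \<le> sum \<rho> (nbhd K Y\<^sub>1 i) / T"
    using cheap_layer[of Y\<^sub>1 K T L] assms by auto
  obtain j where j: "j < L" "sum \<rho> (nbhd K Y\<^sub>2 (Suc j) - nbhd K Y\<^sub>2 j) \<le> sum \<rho> (nbhd K Y\<^sub>2 j) / T"
    using cheap_layer[of Y\<^sub>2 K T L] assms by auto
  have "nbhd K Y\<^sub>1 i \<inter> nbhd K Y\<^sub>2 j = {}"
  proof (rule ccontr)
    assume "\<not> ?thesis"
    then obtain x where x: "x \<in> nbhd K Y\<^sub>1 i" "x \<in> nbhd K Y\<^sub>2 j" by auto
    obtain y k where y: "y \<in> Y\<^sub>1" "k \<le> i" "(y, x) \<in> (Restr E K) ^^ k"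
      using nbhd_walk[OF assms(2) x(1)] by auto
    obtain z k' where z: "z \<in> Y\<^sub>2" "k' \<le> j" "(z, x) \<in> (Restr E K) ^^ k'"
      using nbhd_walk[OF assms(3) x(2)] by auto
    have "sym (Restr E K)" using sym_E by (auto simp: sym_def)
    then have "(x, z) \<in> (Restr E K) ^^ k'" using z relpow_sym by fast
    then have "(y, z) \<in> (Restr E K) ^^ (k + k')" using y by (auto simp: relpow_add)
    \<comment> \<open>Both radii are below \<open>L\<close>, so the joined walk has at most
      \<open>2 * L - 2\<close> steps; hence the form of \<open>far\<close>.\<close>
    then show False using far[OF y(1) z(1), of "k + k'"] y z i j by auto
  qed
  then have "sum w (nbhd K Y\<^sub>1 i) + sum w (nbhd K Y\<^sub>2 j) \<le> sum w V"
    using nbhd_subset[of Y\<^sub>1 K i] nbhd_subset[of Y\<^sub>2 K j] assms by (intro sum_w_disjoint_le) auto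
  then consider "2 * sum w (nbhd K Y\<^sub>1 i) \<le> sum w V" | "2 * sum w (nbhd K Y\<^sub>2 j) \<le> sum w V"
    by linarith
  then show ?thesis
  proof cases
    case 1
    show ?thesis
      by (rule that[of "nbhd K Y\<^sub>1 i" "nbhd K Y\<^sub>1 (Suc i) - nbhd K Y\<^sub>1 i"])
        (use 1 i nbhd_subset[OF assms(2)] nbhd_superset[of Y\<^sub>1 K i] in auto)
  next
    case 2
    show ?thesis
      by (rule that[of "nbhd K Y\<^sub>2 j" "nbhd K Y\<^sub>2 (Suc j) - nbhd K Y\<^sub>2 j"])
        (use 2 j nbhd_subset[OF assms(3)] nbhd_superset[of Y\<^sub>2 K j] in auto)
  qed
qed

end

subsection \<open>The Plotkin-Rao-Smith separator\<close>

lemma Restr_walk_range: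
  assumes "(v, x) \<in> (Restr E K) ^^ k" "v \<in> K"
  obtains f where "f 0 = v" "f k = x" "f ` {..k} \<subseteq> K" "\<And>i. i < k \<Longrightarrow> (f i, f (Suc i)) \<in> E"
proof -
  obtain f where f: "f 0 = v" "f k = x" "\<forall>i<k. (f i, f (Suc i)) \<in> Restr E K"
    using assms(1) unfolding relpow_fun_conv by blast
  have "f i \<in> K" if "i \<le> k" for i
    using f assms(2) that by (cases i) auto
  then show ?thesis using f by (intro that[of f]) auto
qed

lemma walk_prefix:
  assumes "f 0 = v" "f ` {..k} \<subseteq> N" "\<And>i. i < k \<Longrightarrow> (f i, f (Suc i)) \<in> E" "j \<le> k"
  shows "(v, f j) \<in> (Restr E N) ^^ j"
  unfolding relpow_fun_conv using assms by (intro exI[of _ f]) auto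

context weighted_graph
begin

text \<open>The new bag is the union of walks from its centre \<open>v\<close> to a neighbour of
  each old bag. Each walk has at most \<open>l - 2\<close> steps and adds at most that many vertices
  to \<open>v\<close>.\<close>

lemma shallow_clique_insert_tree:
  assumes clique: "shallow_clique E l \<B>" "finite \<B>"
    and "v \<in> K" "K \<subseteq> V" and disj: "\<Union>\<B> \<inter> K = {}"
    and near: "\<And>B. B \<in> \<B> \<Longrightarrow> \<exists>k x. k + 2 \<le> l \<and> (v, x) \<in> (Restr E K) ^^ k \<and> x \<in> E `` B \<inter> K"
    and "0 < l"
  obtains N where "v \<in> N" "N \<subseteq> K" "card N \<le> 1 + card \<B> * (l - 2)" "shallow_clique E l (insert N \<B>)"
proof -
  have "\<exists>f k. k + 2 \<le> l \<and> f 0 = v \<and> f ` {..k} \<subseteq> K \<and> (\<forall>i<k. (f i, f (Suc i)) \<in> E) \<and> f k \<in> E `` B"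
    if "B \<in> \<B>" for B
  proof -
    from near[OF that] obtain k x where "k + 2 \<le> l" "(v, x) \<in> (Restr E K) ^^ k" "x \<in> E `` B"
      by blast
    then show ?thesis using Restr_walk_range[of v x k E K] assms(3) by metis
  qed
  then obtain f k where f: "\<And>B. B \<in> \<B> \<Longrightarrow> k B + 2 \<le> l \<and> f B 0 = v \<and> f B ` {..k B} \<subseteq> K
      \<and> (\<forall>i<k B. (f B i, f B (Suc i)) \<in> E) \<and> f B (k B) \<in> E `` B" by metis
  \<comment> \<open>The index starts at 1 so that the common start \<open>v\<close> is counted only
    once.\<close>
  define N where "N = insert v (\<Union>B\<in>\<B>. f B ` {1..k B})"
  have range: "f B ` {..k B} \<subseteq> N" if "B \<in> \<B>" for B
  proof
    fix x assume "x \<in> f B ` {..k B}"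
    then obtain i where "i \<le> k B" "x = f B i" by auto
    then show "x \<in> N" using f[OF that] that unfolding N_def by (cases i) force+
  qed
  have NK: "N \<subseteq> K"
  proof
    fix x assume "x \<in> N"
    then consider "x = v" | B i where "B \<in> \<B>" "i \<le> k B" "x = f B i" unfolding N_def by auto
    then show "x \<in> K" using assms(3) f by cases (auto simp: image_subset_iff)
  qed
  have "card N \<le> 1 + card (\<Union>B\<in>\<B>. f B ` {1..k B})"
    unfolding N_def using clique(2) by (simp add: card_insert_if)
  also have "card (\<Union>B\<in>\<B>. f B ` {1..k B}) \<le> (\<Sum>B\<in>\<B>. card (f B ` {1..k B}))"
    using clique(2) by (rule card_UN_le)
  also have "\<dots> \<le> card \<B> * (l - 2)"
  proof -
    have "card (f B ` {1..k B}) \<le> l - 2" if "B \<in> \<B>" for B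
    proof -
      have "card (f B ` {1..k B}) \<le> k B" using card_image_le[of "{1..k B}" "f B"] by simp
      moreover have "k B + 2 \<le> l" using f[OF that] by blast
      ultimately show ?thesis by linarith
    qed
    then show ?thesis using sum_bounded_above[of \<B> "\<lambda>B. card (f B ` {1..k B})" "l - 2"] by simp
  qed
  finally have card: "card N \<le> 1 + card \<B> * (l - 2)" by simp
  have radius: "\<exists>j\<le>l. (v, x) \<in> (Restr E N) ^^ j" if "x \<in> N" for x
  proof -
    from that consider "x = v" | B i where "B \<in> \<B>" "i \<le> k B" "x = f B i" unfolding N_def by auto
    then show ?thesis
    proof cases
      case 1
      then show ?thesis by (intro exI[of _ 0]) auto
    next
      case 2
      then have "(v, x) \<in> (Restr E N) ^^ i"
        using walk_prefix[of "f B" v "k B" N E i] f[OF 2(1)] range[OF 2(1)] by auto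
      then show ?thesis using 2 f[OF 2(1)] by (intro exI[of _ i]) auto
    qed
  qed
  have adj: "\<exists>a\<in>N. \<exists>b\<in>B. (a, b) \<in> E" "\<exists>b\<in>B. \<exists>a\<in>N. (b, a) \<in> E" if "B \<in> \<B>" for B
  proof -
    have "f B (k B) \<in> N" using range[OF that] by auto
    then show "\<exists>a\<in>N. \<exists>b\<in>B. (a, b) \<in> E" "\<exists>b\<in>B. \<exists>a\<in>N. (b, a) \<in> E"
      using f[OF that] sym_E by (auto dest: symD)
  qed
  have dN: "N \<inter> B = {}" "B \<inter> N = {}" if "B \<in> \<B>" for B using NK disj that by auto
  have "v \<in> N" unfolding N_def by simp
  have "shallow_clique E l (insert N \<B>)"
    using clique(1) radius adj dN \<open>v \<in> N\<close> unfolding shallow_clique_def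
    by (metis insert_iff)
  then show ?thesis using that \<open>v \<in> N\<close> NK card by blast
qed

text \<open>\<open>K\<close> is the part that is still too heavy and \<open>\<B>\<close> the clique minor built so far.  Either some
  vertex of \<open>K\<close> is close to every bag that has a neighbour in \<open>K\<close>, and short walks to these bags
  form a new bag, or it is far from one of them and a sparse cut shrinks \<open>K\<close>.\<close>

lemma plotkin_rao_smith:
  fixes h l L :: nat
  assumes T: "0 < T" and l: "l = 2 * L" "0 < L"
    and clique_bound: "\<And>\<B>. shallow_clique E l \<B> \<Longrightarrow> finite \<B> \<Longrightarrow> \<Union>\<B> \<subseteq> V \<Longrightarrow> card \<B> \<le> h"
    and K\<^sub>0: "K\<^sub>0 \<subseteq> V" "\<And>v. v \<in> K\<^sub>0 \<Longrightarrow> (1 + 1/T) ^ L * \<rho> v > sum \<rho> V"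
  shows "K \<subseteq> K\<^sub>0 \<Longrightarrow> sum w K > 2/3 * sum w V \<Longrightarrow>
    shallow_clique E l \<B> \<Longrightarrow> finite \<B> \<Longrightarrow> \<Union>\<B> \<subseteq> K\<^sub>0 - K \<Longrightarrow> (\<forall>B\<in>\<B>. card B \<le> h * l) \<Longrightarrow>
    E `` K \<subseteq> K \<union> C \<union> \<Union>\<B> \<Longrightarrow>
    \<exists>S Z. S \<subseteq> K \<and> Z \<subseteq> K\<^sub>0 \<and> card Z \<le> h\<^sup>2 * l \<and> sum \<rho> S \<le> sum \<rho> K / T \<and> separates (C \<union> S \<union> Z)"
proof (induction "card K" arbitrary: K C \<B> rule: less_induct)
  case less
  have KV: "K \<subseteq> V" using less.prems K\<^sub>0 by auto
  then have finK: "finite K" by (rule finite_sub)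
  have WV: "0 \<le> sum w V" by (rule sum_w_nonneg) simp
  have "K \<noteq> {}" using less.prems(2) WV by auto
  then obtain v where v: "v \<in> K" by auto
  have vK0: "v \<in> K\<^sub>0" using v less.prems(1) by auto
  \<comment> \<open>Bags that have lost contact with \<open>K\<close> are dropped. The neighbours of
    \<open>K\<close> stay covered, and each remaining bag has a neighbour in \<open>K\<close> from
    which a ball can be grown.\<close>
  define \<B>' where "\<B>' = {B \<in> \<B>. E `` B \<inter> K \<noteq> {}}"
  have B': "\<B>' \<subseteq> \<B>" "finite \<B>'" using less.prems unfolding \<B>'_def by auto
  have clique': "shallow_clique E l \<B>'" using less.prems(3) B'(1) by (rule shallow_clique_subset)
  have closed': "E `` K \<subseteq> K \<union> C \<union> \<Union>\<B>'"
  proof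
    fix y assume y: "y \<in> E `` K"
    show "y \<in> K \<union> C \<union> \<Union>\<B>'"
    proof (cases "\<exists>B\<in>\<B>. y \<in> B")
      case True
      then obtain B where B: "B \<in> \<B>" "y \<in> B" by auto
      obtain x where "x \<in> K" "(y, x) \<in> E" using y sym_E by (auto dest: symD)
      then have "B \<in> \<B>'" using B unfolding \<B>'_def by auto
      then show ?thesis using B by auto
    qed (use less.prems(7) y in auto)
  qed
  have bagsK0: "\<Union>\<B>' \<subseteq> K\<^sub>0 - K" using less.prems(5) B'(1) by blast
  have bagsV: "\<Union>\<B>' \<subseteq> V" using bagsK0 K\<^sub>0 by auto
  have card_B': "card \<B>' \<le> h" using clique_bound[OF clique' B'(2) bagsV] .
  have wrest: "sum w (V - K) \<le> 2/3 * sum w V"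
    using sum.subset_diff[OF KV finite_V, of w] less.prems(2) WV by simp
  have finite_bags: "finite B" if "B \<in> \<B>" for B
    using that less.prems(5) K\<^sub>0(1) by (intro finite_sub) auto
  show ?case
  proof (cases "\<forall>B\<in>\<B>'. \<exists>k x. k + 2 \<le> l \<and> (v, x) \<in> (Restr E K) ^^ k \<and> x \<in> E `` B \<inter> K")
    case True
    then obtain N where N: "v \<in> N" "N \<subseteq> K" "card N \<le> 1 + card \<B>' * (l - 2)"
      "shallow_clique E l (insert N \<B>')"
      using shallow_clique_insert_tree[OF clique' B'(2) v KV, of thesis] bagsK0 l by auto
    define \<B>'' where "\<B>'' = insert N \<B>'"
    have fin'': "finite \<B>''" and sub'': "\<Union>\<B>'' \<subseteq> V"
      using B' N bagsV KV unfolding \<B>''_def by auto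
    have h: "card \<B>'' \<le> h"
      using clique_bound[of \<B>''] N fin'' sub'' unfolding \<B>''_def by auto
    have "0 < card \<B>''" using fin'' unfolding \<B>''_def by (subst card_gt_0_iff) auto
    then have "1 \<le> h" using h by linarith
    \<comment> \<open>As \<open>1 \<le> h\<close>, the new bag has at most
      \<open>h * (l - 1)\<close> vertices, so the size bound on bags is preserved.\<close>
    have "card N \<le> h + h * (l - 2)"
      using N(3) \<open>1 \<le> h\<close> mult_le_mono1[OF card_B', of "l - 2"] by linarith
    also have "\<dots> \<le> h * l"
      using l by (cases L) (auto simp: algebra_simps)
    finally have cardN: "card N \<le> h * l" .
    have card'': "\<forall>B\<in>\<B>''. card B \<le> h * l" using cardN less.prems(6) B'(1) unfolding \<B>''_def by auto
    define K' where "K' = K - N"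
    have closed'': "E `` K' \<subseteq> K' \<union> C \<union> \<Union>\<B>''" using closed' unfolding K'_def \<B>''_def by auto
    have bags'': "\<Union>\<B>'' \<subseteq> K\<^sub>0 - K'"
      using bagsK0 N(2) less.prems(1) unfolding K'_def \<B>''_def by auto
    show ?thesis
    proof (cases "sum w K' > 2/3 * sum w V")
      case True
      have "card K' < card K" unfolding K'_def using N v finK by (intro psubset_card_mono) auto
      moreover have "K' \<subseteq> K\<^sub>0" using less.prems(1) unfolding K'_def by auto
      ultimately obtain S Z where "S \<subseteq> K'" "Z \<subseteq> K\<^sub>0" "card Z \<le> h\<^sup>2 * l" "sum \<rho> S \<le> sum \<rho> K' / T"
        "separates (C \<union> S \<union> Z)"
        using less.hyps[of K' \<B>'' C] True N(4) fin'' bags'' card'' closed''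
        unfolding \<B>''_def[symmetric] by blast
      moreover have "sum \<rho> K' / T \<le> sum \<rho> K / T"
        using T KV by (intro divide_right_mono sum_rho_mono) (auto simp: K'_def)
      ultimately show ?thesis unfolding K'_def by (meson Diff_subset order.trans)
    next
      case False
      \<comment> \<open>The rest of \<open>K\<close> is no longer heavy, so deleting all bags
        suffices: at most \<open>h\<close> bags of at most \<open>h * l\<close> vertices
        each.\<close>
      have "separates (C \<union> \<Union>\<B>'')"
        by (rule separatesI[of K _ K' "{}"])
          (use KV closed' False wrest WV in \<open>auto simp: K'_def \<B>''_def\<close>)
      moreover have "card (\<Union>\<B>'') \<le> h\<^sup>2 * l"
      proof -
        have "card (\<Union>\<B>'') \<le> (\<Sum>B\<in>\<B>''. card B)" by (rule card_Union_le_sum_card_weak)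
          (use finite_sub sub'' in auto)
        also have "\<dots> \<le> card \<B>'' * (h * l)"
          using sum_bounded_above[of \<B>'' card "h * l"] card'' by simp
        also have "\<dots> \<le> h * (h * l)" using h by simp
        finally show ?thesis by (simp add: power2_eq_square)
      qed
      moreover have "\<Union>\<B>'' \<subseteq> K\<^sub>0" using bags'' by auto
      ultimately show ?thesis
        using sum_rho_nonneg[OF KV] T by (intro exI[of _ "{}"] exI[of _ "\<Union>\<B>''"]) auto
    qed
  next
    case False
    then obtain B where B: "B \<in> \<B>'"
      and far: "\<And>k x. k + 2 \<le> l \<Longrightarrow> (v, x) \<in> (Restr E K) ^^ k \<Longrightarrow> x \<notin> E `` B \<inter> K" by blast
    obtain y where y: "y \<in> E `` B" "y \<in> K" using B unfolding \<B>'_def by auto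
    \<comment> \<open>Already a single vertex of \<open>K\<^sub>0\<close> is costly enough for ball
      growing, hence so are the neighbours of \<open>B\<close> in \<open>K\<close>.\<close>
    have "\<rho> y \<le> sum \<rho> (E `` B \<inter> K)"
      using y finK rho_nonneg KV by (intro member_le_sum) auto
    then have "(1 + 1/T) ^ L * \<rho> y \<le> (1 + 1/T) ^ L * sum \<rho> (E `` B \<inter> K)"
      using T by (intro mult_left_mono) auto
    moreover have "(1 + 1/T) ^ L * \<rho> y > sum \<rho> V" using y less.prems(1) K\<^sub>0(2) by blast
    ultimately have grow: "(1 + 1/T) ^ L * sum \<rho> (E `` B \<inter> K) > sum \<rho> V" by linarith
    obtain D S where D: "D \<subseteq> K" "S \<subseteq> K" "D \<inter> S = {}" "E `` D \<inter> K \<subseteq> D \<union> S"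
      "sum \<rho> S \<le> sum \<rho> D / T" "2 * sum w D \<le> sum w V" "{v} \<subseteq> D \<or> E `` B \<inter> K \<subseteq> D"
    proof (rule sparse_cut[of K "{v}" "E `` B \<inter> K" T L])
      show "\<And>x y k. x \<in> {v} \<Longrightarrow> y \<in> E `` B \<inter> K \<Longrightarrow> k + 2 \<le> 2 * L \<Longrightarrow> (x, y) \<notin> (Restr E K) ^^ k"
        using far l by auto
    qed (use KV v T grow K\<^sub>0(2)[OF vK0] in auto)
    define K' where "K' = K - D - S"
    \<comment> \<open>\<open>D\<close> contains \<open>v\<close> or \<open>y\<close>, so the cut
      makes progress.\<close>
    have "K' \<subset> K" using D v y unfolding K'_def by auto
    then have "card K' < card K" using finK by (intro psubset_card_mono) auto
    have wD: "sum w D \<le> 2/3 * sum w V" using D(6) WV by simp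
    have D_K': "E `` D \<inter> K' = {}" using D unfolding K'_def by auto
    have DV: "D \<subseteq> V" "S \<subseteq> V" "K' \<subseteq> V" using D KV unfolding K'_def by auto
    show ?thesis
    proof (cases "sum w K' > 2/3 * sum w V")
      case True
      have "E `` K' \<inter> D = {}" using D_K' sym_E by (auto dest: symD)
      then have closed'': "E `` K' \<subseteq> K' \<union> (C \<union> S) \<union> \<Union>\<B>'"
        using closed' unfolding K'_def by blast
      have bags: "\<Union>\<B>' \<subseteq> K\<^sub>0 - K'" using bagsK0 unfolding K'_def by auto
      have "\<forall>B\<in>\<B>'. card B \<le> h * l" "K' \<subseteq> K\<^sub>0"
        using less.prems(1,6) B' DV unfolding K'_def by auto
      from less.hyps[OF \<open>card K' < card K\<close> this(2) True clique' B'(2) bags this(1) closed'']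
      obtain S' Z where S': "S' \<subseteq> K'" "Z \<subseteq> K\<^sub>0" "card Z \<le> h\<^sup>2 * l" "sum \<rho> S' \<le> sum \<rho> K' / T"
        "separates (C \<union> S \<union> S' \<union> Z)" by blast
      \<comment> \<open>\<open>S\<close> is charged to \<open>D\<close> and \<open>S'\<close> to
        \<open>K'\<close>. These parts of \<open>K\<close> are disjoint, so the total stays within
        \<open>sum \<rho> K / T\<close>.\<close>
      have "sum \<rho> (S \<union> S') \<le> sum \<rho> S + sum \<rho> S'"
        using S' DV by (intro sum_rho_Un_le) auto
      also have "\<dots> \<le> (sum \<rho> D + sum \<rho> K') / T" using S' D by (simp add: add_divide_distrib)
      also have "sum \<rho> D + sum \<rho> K' = sum \<rho> (D \<union> K')"
        using DV finite_sub by (intro sum.union_disjoint[symmetric]) (auto simp: K'_def)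
      also have "\<dots> / T \<le> sum \<rho> K / T"
        using T KV D by (intro divide_right_mono sum_rho_mono) (auto simp: K'_def)
      finally have "sum \<rho> (S \<union> S') \<le> sum \<rho> K / T" .
      moreover have "S \<union> S' \<subseteq> K" using D S' unfolding K'_def by auto
      moreover have "separates (C \<union> (S \<union> S') \<union> Z)" using S'(5) by (simp add: Un_assoc)
      ultimately show ?thesis using S' by blast
    next
      case False
      have "separates (C \<union> S \<union> \<Union>\<B>')"
        by (rule separatesI[of K _ D K'])
          (use KV closed' False wrest wD D D_K' in \<open>auto simp: K'_def\<close>)
      moreover have "card (\<Union>\<B>') \<le> h\<^sup>2 * l"
      proof -
        have "card (\<Union>\<B>') \<le> (\<Sum>B\<in>\<B>'. card B)" by (rule card_Union_le_sum_card_weak)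
          (use finite_bags B' in auto)
        also have "\<dots> \<le> card \<B>' * (h * l)"
          using sum_bounded_above[of \<B>' card "h * l"] less.prems(6) B' by auto
        also have "\<dots> \<le> h * (h * l)" using card_B' by simp
        finally show ?thesis by (simp add: power2_eq_square)
      qed
      moreover have "sum \<rho> S \<le> sum \<rho> K / T"
        using D(5) divide_right_mono[OF sum_rho_mono[OF D(1) KV], of T] T by linarith
      moreover have "\<Union>\<B>' \<subseteq> K\<^sub>0" using bagsK0 by auto
      ultimately show ?thesis using D(2) by blast
    qed
  qed
qed

end

subsection \<open>Separating the expensive vertices\<close>

lemma relpow_subset: "R \<subseteq> S \<Longrightarrow> R ^^ k \<subseteq> S ^^ k" for R S :: "'a rel"
  by (induction k) auto

context weighted_graph
begin

text \<open>Let \<open>x\<close> be the cost of \<open>X \<inter> K\<close>.  The decay is measured on \<open>x - u\<close> rather than on \<open>x\<close>: if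
  deleting \<open>A\<close> leaves more than \<open>u + 8/9 (x - u)\<close>, the classes group into two parts of cost at
  least \<open>2/9 x + u/9\<close>, which exceeds \<open>u\<close> because \<open>x > 4u\<close>, so balls around both parts can be grown.\<close>

lemma separation_step:
  assumes T: "0 < T" and u: "0 < u" "(1 + 1/T) ^ L * u > sum \<rho> V"
    and K: "K \<subseteq> V" "E `` K \<subseteq> K \<union> C" "sum w K > 2/3 * sum w V"
    and x: "4 * u < sum \<rho> (X \<inter> K)"
    and A: "A \<subseteq> V" and Q: "finite \<Q>" "disjoint \<Q>" "\<Union>\<Q> = X \<inter> K - A"
    and light: "\<And>Q. Q \<in> \<Q> \<Longrightarrow> sum \<rho> Q \<le> 2/3 * sum \<rho> (X \<inter> K)"
    and far: "\<And>Q Q' x y k. Q \<in> \<Q> \<Longrightarrow> Q' \<in> \<Q> \<Longrightarrow> Q \<noteq> Q' \<Longrightarrow> x \<in> Q \<Longrightarrow> y \<in> Q' \<Longrightarrow> k \<le> 2 * L \<Longrightarrow>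
      (x, y) \<notin> (Restr E (V - A)) ^^ k"
  obtains S K' where "S \<subseteq> K" "K' \<subseteq> K" "E `` K' \<subseteq> K' \<union> (C \<union> A \<union> S)" "sum \<rho> S \<le> (sum \<rho> K - sum \<rho> K') / T"
    "separates (C \<union> A \<union> S) \<or>
     sum w K' > 2/3 * sum w V \<and> sum \<rho> (X \<inter> K') - u \<le> 8/9 * (sum \<rho> (X \<inter> K) - u)"
proof -
  define x where "x = sum \<rho> (X \<inter> K)"
  define K\<^sub>0 where "K\<^sub>0 = K - A"
  have closed0: "E `` K\<^sub>0 \<subseteq> K\<^sub>0 \<union> (C \<union> A)" using K(2) unfolding K\<^sub>0_def by auto
  have K0V: "K\<^sub>0 \<subseteq> V" using K(1) unfolding K\<^sub>0_def by auto
  have WV: "0 \<le> sum w V" by (rule sum_w_nonneg) simp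
  have wrest: "sum w (V - K) \<le> 2/3 * sum w V"
    using sum.subset_diff[OF K(1) finite_V, of w] K(3) WV by simp
  show ?thesis
  proof (cases "sum \<rho> (X \<inter> K\<^sub>0) \<le> 8/9 * x + u/9")
    case True
    \<comment> \<open>Deleting \<open>A\<close> alone already gives the decay, so no layer is
      cut.\<close>
    have "separates (C \<union> A)" if "sum w K\<^sub>0 \<le> 2/3 * sum w V"
      by (rule separatesI[of K _ K\<^sub>0 "{}"]) (use K that wrest WV in \<open>auto simp: K\<^sub>0_def\<close>)
    moreover have "sum \<rho> K\<^sub>0 \<le> sum \<rho> K" using K by (intro sum_rho_mono) (auto simp: K\<^sub>0_def)
    moreover have "sum \<rho> (X \<inter> K\<^sub>0) - u \<le> 8/9 * (x - u)" using True by simp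
    ultimately show ?thesis
      using closed0 T unfolding x_def
      by (intro that[of "{}" K\<^sub>0]) (auto simp: K\<^sub>0_def)
  next
    case False
    have QK: "\<Union>\<Q> \<subseteq> K\<^sub>0" using Q(3) unfolding K\<^sub>0_def by auto
    have sum_Un: "sum (sum \<rho>) \<Y> = sum \<rho> (\<Union>\<Y>)" if "\<Y> \<subseteq> \<Q>" for \<Y>
    proof -
      have "finite Q" if "Q \<in> \<Q>" for Q using that QK K0V by (intro finite_sub) auto
      then show ?thesis
        using that disjointD[OF Q(2)] by (subst sum.Union_disjoint) (auto simp: subset_iff)
    qed
    have "\<forall>Q\<in>\<Q>. 0 \<le> sum \<rho> Q \<and> sum \<rho> Q \<le> 2/3 * x"
      using light QK K0V unfolding x_def by (blast intro: sum_rho_nonneg)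
    moreover have "sum (sum \<rho>) \<Q> > 8/9 * x + u/9"
      using False sum_Un[of \<Q>] Q(3) unfolding K\<^sub>0_def by (simp add: Int_Diff)
    ultimately obtain \<Y> where Y: "\<Y> \<subseteq> \<Q>" "sum (sum \<rho>) \<Y> \<ge> 2/9 * x + u/9"
      "sum (sum \<rho>) (\<Q> - \<Y>) \<ge> 2/9 * x + u/9"
      using balanced_bipartition[OF Q(1), of "sum \<rho>" x u] u x unfolding x_def by auto
    define Y\<^sub>1 where "Y\<^sub>1 = \<Union>\<Y>"
    define Y\<^sub>2 where "Y\<^sub>2 = \<Union>(\<Q> - \<Y>)"
    have Y12: "sum \<rho> Y\<^sub>1 \<ge> 2/9 * x + u/9" "sum \<rho> Y\<^sub>2 \<ge> 2/9 * x + u/9"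
      using Y sum_Un[of \<Y>] sum_Un[of "\<Q> - \<Y>"] unfolding Y\<^sub>1_def Y\<^sub>2_def by auto
    have Y12K: "Y\<^sub>1 \<subseteq> K\<^sub>0" "Y\<^sub>2 \<subseteq> K\<^sub>0" "Y\<^sub>1 \<subseteq> X \<inter> K" "Y\<^sub>2 \<subseteq> X \<inter> K"
      using Y QK Q(3) unfolding Y\<^sub>1_def Y\<^sub>2_def by auto
    have grow: "(1 + 1/T) ^ L * y > sum \<rho> V" if "y \<ge> 2/9 * x + u/9" for y
    proof -
      have "u \<le> y" using that x unfolding x_def by simp
      then have "(1 + 1/T) ^ L * u \<le> (1 + 1/T) ^ L * y" using T by (intro mult_left_mono) auto
      then show ?thesis using u(2) by linarith
    qed
    obtain D S where D: "D \<subseteq> K\<^sub>0" "S \<subseteq> K\<^sub>0" "D \<inter> S = {}" "E `` D \<inter> K\<^sub>0 \<subseteq> D \<union> S"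
      "sum \<rho> S \<le> sum \<rho> D / T" "2 * sum w D \<le> sum w V" "Y\<^sub>1 \<subseteq> D \<or> Y\<^sub>2 \<subseteq> D"
    proof (rule sparse_cut[of K\<^sub>0 Y\<^sub>1 Y\<^sub>2 T L])
      fix y z k assume yz: "y \<in> Y\<^sub>1" "z \<in> Y\<^sub>2" "k + 2 \<le> 2 * L"
      then obtain Q Q' where "Q \<in> \<Y>" "y \<in> Q" "Q' \<in> \<Q> - \<Y>" "z \<in> Q'" unfolding Y\<^sub>1_def Y\<^sub>2_def by auto
      then have "(y, z) \<notin> (Restr E (V - A)) ^^ k" using far[of Q Q' y z k] Y(1) yz by auto
      moreover have "Restr E K\<^sub>0 \<subseteq> Restr E (V - A)" using K(1) unfolding K\<^sub>0_def by auto
      ultimately show "(y, z) \<notin> (Restr E K\<^sub>0) ^^ k" using relpow_subset by blast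
    qed (use K0V Y12K T grow[OF Y12(1)] grow[OF Y12(2)] in auto)
    define K' where "K' = K\<^sub>0 - D - S"
    have sub: "D \<subseteq> V" "S \<subseteq> V" "K' \<subseteq> V" "K' \<subseteq> K" "S \<subseteq> K"
      using D K0V unfolding K'_def K\<^sub>0_def by auto
    have D_K': "E `` D \<inter> K' = {}" using D unfolding K'_def by auto
    then have K'_D: "E `` K' \<inter> D = {}" using sym_E by (auto dest: symD)
    have "E `` K' \<subseteq> K' \<union> (C \<union> A \<union> S)" using closed0 K'_D unfolding K'_def by blast
    \<comment> \<open>\<open>S\<close> is charged to \<open>D\<close>, which leaves \<open>K\<close>
      in this round; this form telescopes over the rounds.\<close>
    moreover have "sum \<rho> S \<le> (sum \<rho> K - sum \<rho> K') / T"
    proof -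
      have "sum \<rho> D + sum \<rho> K' = sum \<rho> (D \<union> K')"
        using sub finite_sub by (intro sum.union_disjoint[symmetric]) (auto simp: K'_def)
      also have "\<dots> \<le> sum \<rho> K" using K D by (intro sum_rho_mono) (auto simp: K'_def K\<^sub>0_def)
      finally have "sum \<rho> D / T \<le> (sum \<rho> K - sum \<rho> K') / T" using T by (intro divide_right_mono) auto
      then show ?thesis using D(5) by linarith
    qed
    moreover have "separates (C \<union> A \<union> S)" if "sum w K' \<le> 2/3 * sum w V"
      by (rule separatesI[of K _ D K'])
        (use K that wrest D WV D_K' sub in \<open>auto simp: K'_def K\<^sub>0_def\<close>)
    moreover have "sum \<rho> (X \<inter> K') - u \<le> 8/9 * (x - u)"
    proof -
      \<comment> \<open>\<open>D\<close> swallows one of the two groups whole, so the cost of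
        \<open>X \<inter> K'\<close> is lower than \<open>x\<close> by at least
        \<open>2/9 * x + u/9\<close>.\<close>
      have *: "sum \<rho> (X \<inter> K') \<le> x - sum \<rho> Y" if "Y \<subseteq> X \<inter> K" "Y \<subseteq> D" for Y
      proof -
        have "sum \<rho> (X \<inter> K') \<le> sum \<rho> (X \<inter> K - Y)"
          using K that by (intro sum_rho_mono) (auto simp: K'_def K\<^sub>0_def)
        also have "\<dots> = x - sum \<rho> Y"
          unfolding x_def using that finite_sub K(1) by (subst sum_diff) auto
        finally show ?thesis .
      qed
      have "sum \<rho> (X \<inter> K') \<le> x - (2/9 * x + u/9)"
        using D(7) *[of Y\<^sub>1] *[of Y\<^sub>2] Y12 Y12K by linarith
      moreover have "4 * u < x" using x unfolding x_def .
      ultimately show ?thesis using u(1) by (simp add: field_simps)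
    qed
    ultimately show ?thesis using that[of S K'] sub unfolding x_def by fastforce
  qed
qed

text \<open>The form in which a balanced separator \<open>A\<close> of the weak reachability graph, with outliers \<open>Z\<close>,
  acts on the original graph; the classes \<open>\<Q>\<close> are the traces of its components on \<open>Y\<close>.\<close>

definition far_split :: "'a set \<Rightarrow> nat \<Rightarrow> nat \<Rightarrow> real \<Rightarrow> bool" where
  "far_split Y L q \<delta> \<longleftrightarrow> (\<exists>A Z \<Q>. A \<subseteq> V \<and> Z \<subseteq> A \<and> card Z \<le> q \<and> sum \<rho> (A - Z) \<le> \<delta> \<and>
     finite \<Q> \<and> disjoint \<Q> \<and> \<Union>\<Q> = Y - A \<and> (\<forall>Q\<in>\<Q>. sum \<rho> Q \<le> 2/3 * sum \<rho> Y) \<and>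
     (\<forall>Q\<in>\<Q>. \<forall>Q'\<in>\<Q>. Q \<noteq> Q' \<longrightarrow> (\<forall>x\<in>Q. \<forall>y\<in>Q'. \<forall>k\<le>2 * L. (x, y) \<notin> (Restr E (V - A)) ^^ k)))"

text \<open>The layer of a round is charged to vertices that leave \<open>K\<close> in that round,
  so these costs telescope, while separators and outliers add up. Once \<open>S \<union> Z\<close>
  separates or \<open>X \<inter> K\<close> costs at most \<open>4 * u\<close>, the same sets are
  kept.\<close>

lemma iterated_separation:
  assumes T: "0 < T" and u: "0 < u" "(1 + 1/T) ^ L * u > sum \<rho> V"
    and X: "X \<subseteq> V" "\<And>Y. Y \<subseteq> X \<Longrightarrow> far_split Y L q \<delta>"
    and "0 < sum w V" "0 \<le> \<delta>"
  shows "\<exists>S Z K. S \<subseteq> V \<and> Z \<subseteq> V \<and> card Z \<le> j * q \<and> K \<subseteq> V \<and> E `` K \<subseteq> K \<union> (S \<union> Z) \<and>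
    sum \<rho> S \<le> real j * \<delta> + (sum \<rho> V - sum \<rho> K) / T \<and>
    (separates (S \<union> Z) \<or> sum w K > 2/3 * sum w V \<and>
      (sum \<rho> (X \<inter> K) \<le> 4 * u \<or> sum \<rho> (X \<inter> K) - u \<le> (8/9) ^ j * sum \<rho> V))"
proof (induction j)
  case 0
  have "sum \<rho> (X \<inter> V) \<le> sum \<rho> V" by (rule sum_rho_mono) auto
  then show ?case
    using E_subset assms(6) u(1) by (intro exI[of _ "{}"] exI[of _ V]) auto
next
  case (Suc j)
  then obtain S Z K where IH: "S \<subseteq> V" "Z \<subseteq> V" "card Z \<le> j * q" "K \<subseteq> V" "E `` K \<subseteq> K \<union> (S \<union> Z)"
    "sum \<rho> S \<le> real j * \<delta> + (sum \<rho> V - sum \<rho> K) / T"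
    "separates (S \<union> Z) \<or> sum w K > 2/3 * sum w V \<and>
      (sum \<rho> (X \<inter> K) \<le> 4 * u \<or> sum \<rho> (X \<inter> K) - u \<le> (8/9) ^ j * sum \<rho> V)" by blast
  show ?case
  proof (cases "separates (S \<union> Z) \<or> sum w K > 2/3 * sum w V \<and> sum \<rho> (X \<inter> K) \<le> 4 * u")
    case True
    have "card Z \<le> Suc j * q" using IH(3) by simp
    moreover have "sum \<rho> S \<le> real (Suc j) * \<delta> + (sum \<rho> V - sum \<rho> K) / T"
      using IH(6) assms(7) by (simp add: algebra_simps)
    ultimately show ?thesis using IH True by blast
  next
    case False
    then have K: "sum w K > 2/3 * sum w V" "4 * u < sum \<rho> (X \<inter> K)"
      "sum \<rho> (X \<inter> K) - u \<le> (8/9) ^ j * sum \<rho> V" using IH(7) by auto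
    have "far_split (X \<inter> K) L q \<delta>" by (rule X(2)) auto
    then obtain A Z' \<Q> where A: "A \<subseteq> V" "Z' \<subseteq> A" "card Z' \<le> q" "sum \<rho> (A - Z') \<le> \<delta>"
      "finite \<Q>" "disjoint \<Q>" "\<Union>\<Q> = X \<inter> K - A"
      "\<And>Q. Q \<in> \<Q> \<Longrightarrow> sum \<rho> Q \<le> 2/3 * sum \<rho> (X \<inter> K)"
      "\<And>Q Q' x y k. Q \<in> \<Q> \<Longrightarrow> Q' \<in> \<Q> \<Longrightarrow> Q \<noteq> Q' \<Longrightarrow> x \<in> Q \<Longrightarrow> y \<in> Q' \<Longrightarrow> k \<le> 2 * L \<Longrightarrow>
        (x, y) \<notin> (Restr E (V - A)) ^^ k"
      unfolding far_split_def by (elim exE conjE) metis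
    obtain S' K' where S': "S' \<subseteq> K" "K' \<subseteq> K" "E `` K' \<subseteq> K' \<union> (S \<union> Z \<union> A \<union> S')"
      "sum \<rho> S' \<le> (sum \<rho> K - sum \<rho> K') / T"
      "separates (S \<union> Z \<union> A \<union> S') \<or>
        sum w K' > 2/3 * sum w V \<and> sum \<rho> (X \<inter> K') - u \<le> 8/9 * (sum \<rho> (X \<inter> K) - u)"
      by (rule separation_step[OF T u IH(4,5) K(1,2) A(1) A(5-9)])
    \<comment> \<open>The outliers \<open>Z'\<close> of \<open>A\<close> join \<open>Z\<close>; only
      the rest of \<open>A\<close> has to be paid for.\<close>
    define S'' where "S'' = S \<union> (A - Z') \<union> S'"
    have S''_Z: "S'' \<union> (Z \<union> Z') = S \<union> Z \<union> A \<union> S'" using A(2) unfolding S''_def by auto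
    have sub: "S'' \<subseteq> V" "Z \<union> Z' \<subseteq> V" "K' \<subseteq> V" "A - Z' \<subseteq> V" "S' \<subseteq> V"
      using IH A S' unfolding S''_def by auto
    have "card (Z \<union> Z') \<le> Suc j * q" using card_Un_le[of Z Z'] IH(3) A(3) by simp
    moreover have "sum \<rho> S'' \<le> real (Suc j) * \<delta> + (sum \<rho> V - sum \<rho> K') / T"
    proof -
      have "sum \<rho> S'' \<le> sum \<rho> S + sum \<rho> (A - Z') + sum \<rho> S'"
        unfolding S''_def using sum_rho_Un_le[of "S \<union> (A - Z')" S'] sum_rho_Un_le[of S "A - Z'"] IH sub
        by simp
      also have "\<dots> \<le> real j * \<delta> + (sum \<rho> V - sum \<rho> K) / T + \<delta> + (sum \<rho> K - sum \<rho> K') / T"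
        using IH A S' by linarith
      also have "\<dots> = real (Suc j) * \<delta> + (sum \<rho> V - sum \<rho> K') / T"
        by (simp add: algebra_simps diff_divide_distrib)
      finally show ?thesis .
    qed
    moreover have "sum \<rho> (X \<inter> K') - u \<le> (8/9) ^ Suc j * sum \<rho> V"
      if "sum \<rho> (X \<inter> K') - u \<le> 8/9 * (sum \<rho> (X \<inter> K) - u)"
      using that K(3) by simp
    ultimately show ?thesis using sub S'(3,5) S''_Z by metis
  qed
qed

text \<open>The summands of the bound pay, in order, for the separators of the rounds, all
  breadth-first layers, the remaining \<open>X \<inter> K\<close>, the vertices too cheap to start a
  ball, and the bags of the clique minor. Outliers come from the rounds only.\<close>

lemma separator_from_far_splits:
  fixes h l L M q r :: nat
  assumes T: "0 < T" and u: "0 < u" "(1 + 1/T) ^ L * u > sum \<rho> V" "(8/9) ^ r * sum \<rho> V \<le> 3 * u"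
    and X: "X \<subseteq> V" "\<And>Y. Y \<subseteq> X \<Longrightarrow> far_split Y L q \<delta>" "\<And>v. v \<in> V - X \<Longrightarrow> \<rho> v \<le> c"
    and "0 < sum w V" "0 \<le> \<delta>" "0 \<le> c"
    and l: "l = 2 * M" "0 < M"
    and clique_bound: "\<And>\<B>. shallow_clique E l \<B> \<Longrightarrow> finite \<B> \<Longrightarrow> \<Union>\<B> \<subseteq> V \<Longrightarrow> card \<B> \<le> h"
    and low: "sum \<rho> {v \<in> V. (1 + 1/T) ^ M * \<rho> v \<le> sum \<rho> V} \<le> e"
  shows "\<exists>C Z. C \<subseteq> V \<and> Z \<subseteq> C \<and> card Z \<le> r * q \<and> separates C \<and>
    sum \<rho> (C - Z) \<le> real r * \<delta> + sum \<rho> V / T + 4 * u + e + real (h\<^sup>2 * l) * c"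
proof -
  obtain S Z K where IH: "S \<subseteq> V" "Z \<subseteq> V" "card Z \<le> r * q" "K \<subseteq> V" "E `` K \<subseteq> K \<union> (S \<union> Z)"
    "sum \<rho> S \<le> real r * \<delta> + (sum \<rho> V - sum \<rho> K) / T"
    "separates (S \<union> Z) \<or> sum w K > 2/3 * sum w V \<and>
      (sum \<rho> (X \<inter> K) \<le> 4 * u \<or> sum \<rho> (X \<inter> K) - u \<le> (8/9) ^ r * sum \<rho> V)"
    using iterated_separation[OF T u(1,2) X(1,2) assms(8,9), of r] by blast
  \<comment> \<open>A vertex of \<open>Low\<close> costs too little for ball growing from it alone,
    so all of \<open>Low\<close> is deleted outright.\<close>
  define Low where "Low = {v \<in> V. (1 + 1/T) ^ M * \<rho> v \<le> sum \<rho> V}"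
  have LowV: "Low \<subseteq> V" unfolding Low_def by auto
  define S\<^sub>1 where "S\<^sub>1 = S \<union> (X \<inter> K) \<union> Low"
  define K\<^sub>0 where "K\<^sub>0 = K - X - Low"
  have WV: "0 \<le> sum w V" by (rule sum_w_nonneg) simp
  have S1V: "S\<^sub>1 \<subseteq> V" using IH LowV unfolding S\<^sub>1_def by auto
  have "\<exists>S' Z'. S' \<subseteq> K\<^sub>0 \<and> Z' \<subseteq> K\<^sub>0 \<and> card Z' \<le> h\<^sup>2 * l \<and> sum \<rho> S' \<le> sum \<rho> K / T \<and>
    separates (S\<^sub>1 \<union> Z \<union> S' \<union> Z')"
  proof (cases "separates (S\<^sub>1 \<union> Z)")
    case True
    then show ?thesis
      using sum_rho_nonneg[OF IH(4)] T by (intro exI[of _ "{}"]) auto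
  next
    case False
    have "\<not> separates (S \<union> Z)" using False separates_mono[of "S \<union> Z" "S\<^sub>1 \<union> Z"] unfolding S\<^sub>1_def by auto
    then have wK: "sum w K > 2/3 * sum w V" using IH(7) by auto
    have wrest: "sum w (V - K) \<le> 2/3 * sum w V"
      using sum.subset_diff[OF IH(4) finite_V, of w] wK WV by simp
    have wK0: "sum w K\<^sub>0 > 2/3 * sum w V"
    proof (rule ccontr)
      assume "\<not> ?thesis"
      then have "separates (S\<^sub>1 \<union> Z)"
        by (intro separatesI[of K _ K\<^sub>0 "{}"]) (use IH wrest WV in \<open>auto simp: K\<^sub>0_def S\<^sub>1_def\<close>)
      then show False using False by simp
    qed
    have K0V: "K\<^sub>0 \<subseteq> V" using IH unfolding K\<^sub>0_def by auto
    have "\<exists>S' Z'. S' \<subseteq> K\<^sub>0 \<and> Z' \<subseteq> K\<^sub>0 \<and> card Z' \<le> h\<^sup>2 * l \<and> sum \<rho> S' \<le> sum \<rho> K\<^sub>0 / T \<and>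
      separates (S\<^sub>1 \<union> Z \<union> S' \<union> Z')"
    proof (rule plotkin_rao_smith[OF T l clique_bound K0V _ subset_refl wK0])
      show "(1 + 1/T) ^ M * \<rho> v > sum \<rho> V" if "v \<in> K\<^sub>0" for v
        using that IH(4) unfolding K\<^sub>0_def Low_def by auto
      show "E `` K\<^sub>0 \<subseteq> K\<^sub>0 \<union> (S\<^sub>1 \<union> Z) \<union> \<Union>{}"
        using IH(5) unfolding K\<^sub>0_def S\<^sub>1_def by blast
      show "shallow_clique E l {}" unfolding shallow_clique_def by simp
    qed auto
    moreover have "sum \<rho> K\<^sub>0 / T \<le> sum \<rho> K / T"
      using T IH by (intro divide_right_mono sum_rho_mono) (auto simp: K\<^sub>0_def)
    ultimately show ?thesis by (meson order.trans)
  qed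
  then obtain S' Z' where S': "S' \<subseteq> K\<^sub>0" "Z' \<subseteq> K\<^sub>0" "card Z' \<le> h\<^sup>2 * l" "sum \<rho> S' \<le> sum \<rho> K / T"
    "separates (S\<^sub>1 \<union> Z \<union> S' \<union> Z')" by blast
  show ?thesis
  proof (cases "separates (S \<union> Z)")
    case True
    have "sum \<rho> (S \<union> Z - Z) \<le> sum \<rho> S" using IH by (intro sum_rho_mono) auto
    also have "\<dots> \<le> real r * \<delta> + sum \<rho> V / T"
      using IH(6) T sum_rho_nonneg[OF IH(4)] divide_right_mono[of "sum \<rho> V - sum \<rho> K" "sum \<rho> V" T] by linarith
    also have "\<dots> \<le> real r * \<delta> + sum \<rho> V / T + 4 * u + e + real (h\<^sup>2 * l) * c"
    proof -
      have "0 \<le> e" using low sum_rho_nonneg[OF LowV] unfolding Low_def by linarith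
      moreover have "0 \<le> real (h\<^sup>2 * l) * c" using assms(10) by (intro mult_nonneg_nonneg) auto
      ultimately show ?thesis using u(1) by linarith
    qed
    finally show ?thesis using IH True by (intro exI[of _ "S \<union> Z"] exI[of _ Z]) auto
  next
    case False
    \<comment> \<open>After \<open>r\<close> rounds the excess over \<open>u\<close> is at most
      \<open>3 * u\<close>, which gives \<open>4 * u\<close> in both alternatives.\<close>
    then have XK: "sum \<rho> (X \<inter> K) \<le> 4 * u" using IH(7) u(3) by auto
    have sub: "S' \<subseteq> V" "Z' \<subseteq> V" "Z' \<subseteq> V - X" using S' IH unfolding K\<^sub>0_def by auto
    have Z'_cheap: "sum \<rho> Z' \<le> real (h\<^sup>2 * l) * c"
    proof -
      have "sum \<rho> Z' \<le> real (card Z') * c" using sum_bounded_above[of Z' \<rho> c] X(3) sub by auto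
      also have "\<dots> \<le> real (h\<^sup>2 * l) * c" using S'(3) assms(10) by (intro mult_right_mono) (simp only: of_nat_le_iff)
      finally show ?thesis .
    qed
    have "sum \<rho> (S\<^sub>1 \<union> Z \<union> S' \<union> Z' - Z) \<le> sum \<rho> (S\<^sub>1 \<union> S' \<union> Z')"
      using S1V sub by (intro sum_rho_mono) auto
    also have "\<dots> \<le> sum \<rho> S + sum \<rho> (X \<inter> K) + sum \<rho> Low + sum \<rho> S' + sum \<rho> Z'"
      using sum_rho_Un_le[of "S\<^sub>1 \<union> S'" Z'] sum_rho_Un_le[of S\<^sub>1 S'] S1V sub
        sum_rho_Un_le[of "S \<union> (X \<inter> K)" Low] sum_rho_Un_le[of S "X \<inter> K"] IH LowV
      unfolding S\<^sub>1_def by force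
    \<comment> \<open>The last layers are charged to \<open>K\<close> and those of the rounds to its
      complement, so together they cost at most \<open>sum \<rho> V / T\<close>.\<close>
    also have "\<dots> \<le> (real r * \<delta> + (sum \<rho> V - sum \<rho> K) / T) + 4 * u + e + sum \<rho> K / T + real (h\<^sup>2 * l) * c"
      using IH(6) XK low S'(4) Z'_cheap unfolding Low_def by linarith
    also have "\<dots> = real r * \<delta> + sum \<rho> V / T + 4 * u + e + real (h\<^sup>2 * l) * c"
      by (simp add: diff_divide_distrib)
    finally show ?thesis
      using S' S1V sub IH by (intro exI[of _ "S\<^sub>1 \<union> Z \<union> S' \<union> Z'"] exI[of _ Z]) auto
  qed
qed

end

subsection \<open>Clique minors, separators and weak reachability in pair graphs\<close>

definition induced :: "'a pair_pre_digraph \<Rightarrow> 'a set \<Rightarrow> 'a pair_pre_digraph" where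
  "induced G U = \<lparr>pverts = U, parcs = Restr (parcs G) U\<rparr>"

lemma induced_simps [simp]: "pverts (induced G U) = U" "parcs (induced G U) = Restr (parcs G) U"
  unfolding induced_def by auto

lemma induced_induced: "B \<subseteq> U \<Longrightarrow> induced (induced G U) B = induced G B"
  unfolding induced_def by auto

lemma pair_graphI:
  assumes "finite (pverts G)" "parcs G \<subseteq> pverts G \<times> pverts G" "sym (parcs G)"
    "\<And>v. (v, v) \<notin> parcs G"
  shows "pair_graph G"
proof
  show "finite (parcs G)" using assms finite_subset by blast
  show "symmetric (with_proj G)" using assms unfolding symmetric_def by simp
  fix e assume "e \<in> parcs G"
  then show "fst e \<in> pverts G" "snd e \<in> pverts G" "fst e \<noteq> snd e"
    using assms by (cases e; auto)+
qed (use assms in auto)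

lemma pair_graphD:
  assumes "pair_graph G"
  shows "finite (pverts G)" "parcs G \<subseteq> pverts G \<times> pverts G" "sym (parcs G)" "\<And>v. (v, v) \<notin> parcs G"
    "pair_wf_digraph G"
proof -
  interpret pair_graph G by fact
  show "finite (pverts G)" by (rule pair_finite_verts)
  show "parcs G \<subseteq> pverts G \<times> pverts G" using wellformed' by auto
  show "sym (parcs G)" using arcs_symmetric by (auto simp: sym_def)
  show "(v, v) \<notin> parcs G" for v using no_loops' by auto
  show "pair_wf_digraph G" by unfold_locales
qed

lemma pair_graph_induced: "pair_graph G \<Longrightarrow> U \<subseteq> pverts G \<Longrightarrow> pair_graph (induced G U)"
  using pair_graphD[of G] by (intro pair_graphI) (auto simp: sym_def intro: finite_subset)

lemma simple_subgraph_induced: "pair_graph G \<Longrightarrow> U \<subseteq> pverts G \<Longrightarrow> simple_subgraph (induced G U) G"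
  unfolding simple_subgraph_def subgraph_def
  using pair_graph_induced[of G U] by (auto simp: wf_digraph_wp_iff dest: pair_graphD)

context pair_wf_digraph
begin

lemma relpow_awalk:
  assumes "(u, v) \<in> (Restr (parcs G) K) ^^ k" "u \<in> pverts G"
  shows "\<exists>p. awalk u p v \<and> length p = k \<and> set p \<subseteq> K \<times> K"
  using assms
proof (induction k arbitrary: u)
  case 0
  then show ?case by (intro exI[of _ "[]"]) (auto simp: awalk_Nil_iff)
next
  case (Suc k)
  then obtain z where z: "(u, z) \<in> Restr (parcs G) K" "(z, v) \<in> (Restr (parcs G) K) ^^ k"
    by (meson relpow_Suc_D2)
  then obtain p where "awalk z p v" "length p = k" "set p \<subseteq> K \<times> K"
    using Suc.IH[OF z(2)] in_arcsD2 by blast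
  then show ?case using z by (intro exI[of _ "(u, z) # p"]) (auto simp: awalk_Cons_iff)
qed

lemma set_pawalk_verts_subset: "set (pawalk_verts u p) \<subseteq> insert u (fst ` set p \<union> snd ` set p)"
  by (induction p arbitrary: u) auto

text \<open>Shortening a walk to a path uses only arcs of the walk. A path repeats no arc, so its
  length counts distinct arcs of the walk and is at most \<open>k\<close>.\<close>

lemma relpow_apath:
  assumes "(u, v) \<in> (Restr (parcs G) K) ^^ k" "u \<in> K" "K \<subseteq> pverts G"
  shows "\<exists>p. apath u p v \<and> length p \<le> k \<and> set (pawalk_verts u p) \<subseteq> K"
proof -
  obtain p where p: "awalk u p v" "length p = k" "set p \<subseteq> K \<times> K"
    using relpow_awalk assms by blast
  define q where "q = awalk_to_apath p"
  have q: "apath u q v" unfolding q_def using p(1) by (rule apath_awalk_to_apath)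
  have sub: "set q \<subseteq> set p" unfolding q_def using p(1) by (rule awalk_to_apath_subset)
  have "distinct q" using q distinct_verts_imp_distinct unfolding apath_def by blast
  then have "length q = card (set q)" by (simp add: distinct_card)
  also have "\<dots> \<le> length p" using sub by (meson card_length card_mono finite_set le_trans)
  finally have "length q \<le> k" using p by simp
  moreover have "set (pawalk_verts u q) \<subseteq> K"
    using set_pawalk_verts_subset[of u q] sub p(3) assms(2) by fastforce
  ultimately show ?thesis using q by blast
qed

end

lemma finite_simple_subgraphs:
  assumes "pair_graph G"
  shows "finite {H. simple_subgraph H G}"
proof (rule finite_subset)
  let ?mk = "\<lambda>(A, B). \<lparr>pverts = A, parcs = B\<rparr> :: 'a pair_pre_digraph"
  show "{H. simple_subgraph H G} \<subseteq> ?mk ` (Pow (pverts G) \<times> Pow (parcs G))"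
  proof
    fix H assume "H \<in> {H. simple_subgraph H G}"
    then have "pverts H \<subseteq> pverts G" "parcs H \<subseteq> parcs G"
      unfolding simple_subgraph_def subgraph_def by auto
    then show "H \<in> ?mk ` (Pow (pverts G) \<times> Pow (parcs G))"
      by (intro image_eqI[of _ _ "(pverts H, parcs H)"]) auto
  qed
  have "finite (parcs G)" using pair_graphD(1,2)[OF assms] finite_subset by blast
  then show "finite (?mk ` (Pow (pverts G) \<times> Pow (parcs G)))"
    using pair_graphD(1)[OF assms] by simp
qed

section \<open>Shallow cliques and \<open>omega\<close>\<close>

text \<open>Walks from \<open>c\<close> inside \<open>B\<close> shorten to paths of
  \<open>induced G B\<close>, so \<open>c\<close> is a candidate in the minimum over centres that
  defines \<open>radius\<close>.\<close>

lemma induced_bag: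
  assumes G: "pair_graph G" and B: "B \<subseteq> pverts G" "c \<in> B"
    and near: "\<forall>x\<in>B. \<exists>k\<le>l. (c, x) \<in> (Restr (parcs G) B) ^^ k"
  shows "Digraph_Component.connected (with_proj (induced G B))" "radius (induced G B) \<le> l"
proof -
  let ?H = "induced G B"
  interpret H: pair_graph ?H using pair_graph_induced[OF G B(1)] .
  have R: "Restr (parcs ?H) B = Restr (parcs G) B" by auto
  have path: "\<exists>p. H.apath c p x \<and> length p \<le> l" if "x \<in> B" for x
  proof -
    from that near R obtain k where "k \<le> l" "(c, x) \<in> (Restr (parcs ?H) B) ^^ k" by metis
    then show ?thesis using H.relpow_apath[of c x k B] B by (auto intro: order.trans)
  qed
  then have reach: "reachable (with_proj ?H) c x" if "x \<in> B" for x
    using that H.reachable_apath by blast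
  show "Digraph_Component.connected (with_proj ?H)"
  proof (rule H.connectedI)
    fix u v assume "u \<in> pverts ?H" "v \<in> pverts ?H"
    then have "reachable (with_proj ?H) u v"
      using reach H.symmetric_reachable' H.reachable_trans by (metis induced_simps(1))
    then show "reachable (with_proj (mk_symmetric (with_proj ?H))) u v" by (rule H.reachable_mk_symmetricI)
  qed (use B in auto)
  have fin: "finite B" using G B pair_graphD(1) finite_subset by blast
  have "gdist ?H c x \<le> l" if "x \<in> B" for x
  proof -
    obtain p where p: "H.apath c p x" "length p \<le> l" using path[OF \<open>x \<in> B\<close>] by auto
    have "gdist ?H c x \<le> length p" unfolding gdist_def by (rule Least_le) (use p in blast)
    then show ?thesis using p by simp
  qed
  then have "Max (gdist ?H c ` B) \<le> l" using fin B by (subst Max_le_iff) auto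
  moreover have "radius ?H \<le> Max (gdist ?H c ` B)"
    unfolding radius_def using fin B by (intro Min_le) auto
  ultimately show "radius ?H \<le> l" by simp
qed

text \<open>Contracting the bags in the subgraph induced on their union leaves no uncontracted
  vertices, so the minor has exactly the bags as vertices and is complete.\<close>

lemma card_shallow_clique_le_omega:
  assumes G: "pair_graph G" and clique: "shallow_clique (parcs G) l \<B>" and "finite \<B>" "\<Union>\<B> \<subseteq> pverts G"
  shows "card \<B> \<le> omega l G"
proof -
  define G' where "G' = induced G (\<Union>\<B>)"
  define F where "F = induced G ` \<B>"
  define M where "M = contract G' F"
  have G': "pair_graph G'" "simple_subgraph G' G"
    using pair_graph_induced[OF G assms(4)] simple_subgraph_induced[OF G assms(4)] unfolding G'_def by auto
  have verts_F: "pverts ` F = \<B>" unfolding F_def by (auto simp: image_image)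
  have "\<Union> (pverts ` F) = \<Union>\<B>" using verts_F by simp
  then have verts_M: "pverts M = \<B>"
    unfolding M_def contract_def Let_def using verts_F by (auto simp: G'_def)
  have "parcs M = {(A, B). (A, B) \<in> \<B> \<times> \<B> \<and> A \<noteq> B}"
  proof -
    have "\<exists>a\<in>A. \<exists>b\<in>B. (a, b) \<in> parcs G'" if AB: "A \<in> \<B>" "B \<in> \<B>" "A \<noteq> B" for A B
    proof -
      obtain a b where "a \<in> A" "b \<in> B" "(a, b) \<in> parcs G"
        using clique AB unfolding shallow_clique_def by blast
      then show ?thesis using AB unfolding G'_def by auto
    qed
    moreover have "parcs M = {(A, B). A \<in> pverts M \<and> B \<in> pverts M \<and> A \<noteq> B \<and> (\<exists>a\<in>A. \<exists>b\<in>B. (a, b) \<in> parcs G')}"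
      unfolding M_def contract_def Let_def by simp
    ultimately show ?thesis unfolding verts_M by auto
  qed
  then have complete: "complete_digraph (card \<B>) (with_proj M)"
    unfolding complete_digraph_pair_def verts_M using \<open>finite \<B>\<close> by auto
  have "simple_subgraph K G' \<and> Digraph_Component.connected (with_proj K) \<and> radius K \<le> l"
    if "K \<in> F" for K
  proof -
    from that obtain B where B: "B \<in> \<B>" "K = induced G B" unfolding F_def by auto
    then have K: "K = induced G' B" unfolding G'_def by (subst induced_induced) auto
    obtain c where "c \<in> B" "\<forall>x\<in>B. \<exists>k\<le>l. (c, x) \<in> (Restr (parcs G) B) ^^ k"
      using clique B unfolding shallow_clique_def by blast
    moreover have "simple_subgraph (induced G' B) G'"
      using B(1) by (intro simple_subgraph_induced[OF G'(1)]) (auto simp: G'_def)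
    moreover have "B \<subseteq> pverts G" using B(1) assms(4) by auto
    ultimately show ?thesis
      using induced_bag[OF G, of B c l] unfolding K[symmetric] B(2)[symmetric] by blast
  qed
  moreover have "\<forall>K\<in>F. \<forall>K'\<in>F. K \<noteq> K' \<longrightarrow> pverts K \<inter> pverts K' = {}"
    using clique unfolding F_def shallow_clique_def by fastforce
  ultimately have M: "M \<in> depth_minors l G"
    unfolding depth_minors_def M_def using G'(2) by blast
  \<comment> \<open>The maximum in \<open>omega\<close> needs a finite set. Vertices of a minor are
    sets of vertices of \<open>G\<close>, which bounds the clique size by the number of such
    sets.\<close>
  have "{k. \<exists>M\<in>depth_minors l G. complete_digraph k (with_proj M)} \<subseteq> {..card (Pow (pverts G))}"
  proof
    fix k assume "k \<in> {k. \<exists>M\<in>depth_minors l G. complete_digraph k (with_proj M)}"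
    then obtain M where M: "M \<in> depth_minors l G" "complete_digraph k (with_proj M)" by auto
    then obtain G' F where GF: "M = contract G' F" "simple_subgraph G' G" "\<forall>K\<in>F. simple_subgraph K G'"
      unfolding depth_minors_def by auto
    have "pverts G' \<subseteq> pverts G" "\<forall>K\<in>F. pverts K \<subseteq> pverts G'"
      using GF unfolding simple_subgraph_def subgraph_def by auto
    then have "pverts M \<subseteq> Pow (pverts G)" unfolding GF(1) contract_def Let_def by auto
    moreover have "card (pverts M) = k" using M(2) unfolding complete_digraph_pair_def by simp
    ultimately show "k \<in> {..card (Pow (pverts G))}"
      using pair_graphD(1)[OF G] card_mono[of "Pow (pverts G)" "pverts M"] by simp
  qed
  then have "finite {k. \<exists>M\<in>depth_minors l G. complete_digraph k (with_proj M)}"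
    using finite_subset by blast
  then show ?thesis unfolding omega_def using M complete by (intro Max_ge) auto
qed

section \<open>Components and balanced separators\<close>

text \<open>Connectedness of a digraph is strong connectedness of its symmetric closure, whose arcs
  lie in \<open>E\<close> here. A nonempty closed part of a component therefore contains all of it,
  so components are linked.\<close>

lemma (in weighted_graph) separates_imp_balanced_separator:
  assumes "V = pverts G" "E = parcs G" "pair_graph G" "C \<subseteq> V" "separates C"
  shows "balanced_separator G w C"
  unfolding balanced_separator_def
proof (intro conjI allI impI)
  interpret G: pair_graph G by fact
  fix K assume "pre_digraph.max_subgraph (with_proj G \<restriction> (pverts G - C)) Digraph_Component.connected K"
  then have K: "subgraph K (with_proj G \<restriction> (pverts G - C))" "Digraph_Component.connected K"
    unfolding pre_digraph.max_subgraph_def by auto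
  have "linked (verts K)"
    unfolding linked_def
  proof (intro allI impI, elim conjE)
    fix P assume P: "P \<subseteq> verts K" "P \<noteq> {}" "E `` P \<inter> verts K \<subseteq> P"
    then obtain u where u: "u \<in> P" by auto
    have arcs: "parcs (mk_symmetric K) \<subseteq> E"
    proof -
      have "arcs K \<subseteq> parcs G" "tail K = fst" "head K = snd"
        using K(1) unfolding subgraph_def compatible_def by auto
      then show ?thesis using sym_E assms(2) unfolding mk_symmetric_def by (auto dest: symD)
    qed
    interpret KS: pair_wf_digraph "mk_symmetric K"
      using K(1) by (auto intro: wf_digraph.wellformed_mk_symmetric)
    have "v \<in> P" if v: "v \<in> verts K" for v
    proof -
      have "reachable (with_proj (mk_symmetric K)) u v"
        using K(2) u v P(1) unfolding connected_def strongly_connected_def by auto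
      then show ?thesis
      proof (induction rule: KS.reachable_induct)
        case base
        then show ?case using u by simp
      next
        case (step x y)
        then have "(x, y) \<in> E" "y \<in> verts K" using arcs KS.in_arcsD2 by auto
        then show ?case using step P(3) by auto
      qed
    qed
    then show "P = verts K" using P(1) by auto
  qed
  moreover have "verts K \<subseteq> V - C" using K(1) assms(1) unfolding subgraph_def by auto
  ultimately show "sum w (verts K) \<le> 2 / 3 * sum w (pverts G)"
    using assms(1,5) unfolding separates_def by auto
qed (use assms in auto)

text \<open>This makes the balance condition applicable to reachability classes. A connected
  subgraph of \<open>D\<close> containing the class lies within it, as \<open>D\<close> is
  symmetric, and then has the same vertices and arcs.\<close>

lemma connected_component_max_subgraph:
  fixes D :: "('a, 'b) pre_digraph"
  assumes "sym_digraph D" "u \<in> verts D"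
  shows "pre_digraph.max_subgraph D Digraph_Component.connected (D \<restriction> {v. reachable D u v})"
proof -
  interpret D: sym_digraph D by fact
  let ?S = "{v. reachable D u v}"
  let ?C = "D \<restriction> ?S"
  have sub: "subgraph ?C D" by (rule D.subgraph_induce_subgraphI) (auto elim: reachable_in_vertsE)
  have conn: "Digraph_Component.connected ?C"
  proof -
    interpret C: wf_digraph ?C by (rule D.wellformed_induce_subgraph)
    have "strongly_connected ?C"
      using D.induce_reachable_is_in_sccs[OF assms(2)] unfolding D.sccs_def by auto
    then show ?thesis
      by (auto intro!: C.connectedI C.reachable_mk_symmetricI simp: strongly_connected_def)
  qed
  show ?thesis
  proof (rule D.max_subgraphI[of Digraph_Component.connected, OF conn sub])
    fix H assume H: "?C \<noteq> H" "subgraph ?C H" "subgraph H D"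
    show "\<not> Digraph_Component.connected H"
    proof
      assume c: "Digraph_Component.connected H"
      have compat: "tail H = tail D" "head H = head D" using H(3) by (auto simp: subgraph_def compatible_def)
      interpret H: wf_digraph H using H(3) by auto
      have "u \<in> verts H" using H(2) assms(2) by (auto simp: subgraph_def)
      have "verts H \<subseteq> ?S"
      proof
        fix v assume "v \<in> verts H"
        then have "reachable (with_proj (mk_symmetric H)) u v"
          using c \<open>u \<in> verts H\<close> unfolding connected_def strongly_connected_def by auto
        then have "reachable (with_proj (mk_symmetric D)) u v"
          using subgraph_mk_symmetric[OF H(3)] by (rule pre_digraph.reachable_mono)
        then show "v \<in> ?S" using D.reachable_mk_symmetric_eq[OF D.sym_arcs] by auto
      qed
      moreover have "?S \<subseteq> verts H" using H(2) by (auto simp: subgraph_def)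
      ultimately have "verts H = ?S" by auto
      moreover have "arcs H = arcs ?C"
      proof
        show "arcs ?C \<subseteq> arcs H" using H(2) by (auto simp: subgraph_def)
        show "arcs H \<subseteq> arcs ?C"
        proof
          fix a assume a: "a \<in> arcs H"
          then have "tail H a \<in> verts H" "head H a \<in> verts H" by auto
          moreover have "a \<in> arcs D" using a H(3) by (auto simp: subgraph_def)
          ultimately show "a \<in> arcs ?C" using \<open>verts H = ?S\<close> compat by auto
        qed
      qed
      ultimately have "H = ?C" using compat by (intro pre_digraph.equality) auto
      then show False using H(1) by simp
    qed
  qed
qed

section \<open>Weak reachability\<close>

lemma linear_order_on_finite_least:
  assumes "linear_order_on A r" "finite S" "S \<noteq> {}" "S \<subseteq> A"
  shows "\<exists>z\<in>S. \<forall>x\<in>S. (z, x) \<in> r"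
  using assms(2-4)
proof (induction S rule: finite_ne_induct)
  case (singleton x)
  then show ?case using assms(1) unfolding order_on_defs refl_on_def by auto
next
  case (insert x F)
  then obtain z where z: "z \<in> F" "\<forall>y\<in>F. (z, y) \<in> r" by auto
  have "(x, x) \<in> r" "(x, z) \<in> r \<or> (z, x) \<in> r" and tr: "trans r"
    using assms(1) insert z unfolding order_on_defs refl_on_def total_on_def by auto
  then show ?case using z transD[OF tr] by (metis insert_iff)
qed

lemma length_rev_path [simp]: "length (rev_path p) = length p"
  by (induction p) auto

text \<open>The witness is the least vertex of the walk.\<close>

lemma short_walk_common_wreach:
  assumes G: "pair_graph G" and ord: "linear_order_on (pverts G) ord"
    and walk: "(x, y) \<in> (Restr (parcs G) U) ^^ k" "k \<le> m" "x \<in> U" "U \<subseteq> pverts G"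
  shows "\<exists>z\<in>U. z \<in> wreach G ord m x \<and> z \<in> wreach G ord m y"
proof -
  interpret G: pair_graph G by fact
  obtain p where p: "G.apath x p y" "length p \<le> m" "set (pawalk_verts x p) \<subseteq> U"
    using G.relpow_apath[OF walk(1,3,4)] walk(2) by auto
  have "pawalk_verts x p \<noteq> []" by (cases p) auto
  then obtain z where z: "z \<in> set (pawalk_verts x p)" "\<forall>v\<in>set (pawalk_verts x p). (z, v) \<in> ord"
    using linear_order_on_finite_least[OF ord, of "set (pawalk_verts x p)"] p(3) walk(4) by auto
  have "G.awalk x p y" using p(1) by (rule G.awalkI_apath)
  \<comment> \<open>The path is split at its least vertex; the second half, reversed, leads from
    \<open>y\<close> to \<open>z\<close>.\<close>
  then obtain q s where qs: "p = q @ s" "G.awalk x q z" "G.awalk z s y"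
    using G.awalk_decomp z(1) by blast
  have verts: "set (pawalk_verts x p) = set (pawalk_verts x q) \<union> set (pawalk_verts z s)"
    using G.set_awalk_verts_append[OF qs(2,3)] qs(1) by simp
  have "last (pawalk_verts x q) = z" using qs(2) by auto
  moreover have "G.apath x (q @ s) y" using p(1) qs(1) by simp
  ultimately have ap: "G.apath x q z" "G.apath z s y" unfolding G.apath_append_iff by auto
  have "z \<in> wreach G ord m x"
    unfolding wreach_def using ap(1) p(2) qs(1) z(2) verts by auto
  moreover have "z \<in> wreach G ord m y"
  proof -
    have "G.apath y (rev_path s) z" using ap(2) by simp
    moreover have "set (pawalk_verts y (rev_path s)) = set (pawalk_verts z s)"
      using G.awalk_verts_rev_path[OF qs(3)] by simp
    ultimately show ?thesis
      unfolding wreach_def using p(2) qs(1) z(2) verts by (intro CollectI exI[of _ "rev_path s"]) auto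
  qed
  ultimately show ?thesis using z(1) p(3) by blast
qed

lemma wreach_subset: "pair_graph G \<Longrightarrow> wreach G ord m v \<subseteq> pverts G"
proof
  fix u assume "pair_graph G" "u \<in> wreach G ord m v"
  then interpret G: pair_graph G by simp
  obtain p where "G.apath v p u" using \<open>u \<in> wreach G ord m v\<close> unfolding wreach_def by auto
  then show "u \<in> pverts G" using G.awalkI_apath G.awalk_last_in_verts by blast
qed

lemma wreach_refl:
  assumes "pair_graph G" "linear_order_on (pverts G) ord" "v \<in> pverts G"
  shows "v \<in> wreach G ord m v"
proof -
  interpret G: pair_graph G by fact
  have "(v, v) \<in> ord" using assms(2,3) unfolding order_on_defs refl_on_def by auto
  then show ?thesis
    unfolding wreach_def using assms(3) by (intro CollectI exI[of _ "[]"]) (auto simp: G.apath_Nil_iff)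
qed

lemma card_wreach_le_wcol:
  assumes "pair_graph G" "v \<in> pverts G"
  shows "card (wreach G ord m v) \<le> wcol G ord m"
  unfolding wcol_def using pair_graphD(1)[OF assms(1)] assms(2) by (intro Max_ge) auto

lemma pair_graph_wreach_graph: "pair_graph G \<Longrightarrow> pair_graph (wreach_graph G ord m)"
  unfolding wreach_graph_def by (rule pair_graphI) (auto simp: sym_def dest: pair_graphD)

section \<open>Attainment of the extrema in \<open>eta\<close> and \<open>eta_le\<close>\<close>

text \<open>Deleting every vertex as an outlier is always admissible, so the minimum that defines
  \<open>eta\<close> exists and is attained.\<close>

lemma eta_separator:
  assumes "pair_graph H" "assignment H w" "assignment H \<rho>"
  shows "\<exists>C. balanced_separator H w C \<and> cheap_with_outliers H \<rho> t (eta H t) C"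
proof -
  let ?P = "\<lambda>q. \<forall>w \<rho>. assignment H w \<and> assignment H \<rho> \<longrightarrow>
     (\<exists>C. balanced_separator H w C \<and> cheap_with_outliers H \<rho> t q C)"
  have "?P (card (pverts H))"
  proof (intro allI impI)
    fix w \<rho> assume a: "assignment H w \<and> assignment H \<rho>"
    have "balanced_separator H w (pverts H)"
      unfolding balanced_separator_def pre_digraph.max_subgraph_def connected_def strongly_connected_def subgraph_def
      by auto
    moreover have "0 \<le> sum \<rho> (pverts H) / real t"
      using a unfolding assignment_def by (intro divide_nonneg_nonneg sum_nonneg) auto
    then have "cheap_with_outliers H \<rho> t (card (pverts H)) (pverts H)"
      unfolding cheap_with_outliers_def by (intro exI[of _ "pverts H"]) auto
    ultimately show "\<exists>C. balanced_separator H w C \<and> cheap_with_outliers H \<rho> t (card (pverts H)) C"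
      by blast
  qed
  then have "?P (eta H t)" unfolding eta_def by (rule LeastI)
  then show ?thesis using assms by blast
qed

text \<open>There are only finitely many subgraphs, so the maximum is a genuine upper bound.\<close>

lemma eta_le_eta_le_subgraph:
  assumes "pair_graph H" "simple_subgraph H' H" "card (pverts H') \<le> n"
  shows "eta H' t \<le> eta_le n H t"
proof -
  have "{eta H' t | H'. simple_subgraph H' H \<and> card (pverts H') \<le> n} \<subseteq> (\<lambda>H'. eta H' t) ` {H'. simple_subgraph H' H}"
    by auto
  then have "finite {eta H' t | H'. simple_subgraph H' H \<and> card (pverts H') \<le> n}"
    using finite_simple_subgraphs[OF assms(1)] finite_surj by blast
  then show ?thesis unfolding eta_le_def using assms by (intro Max_ge) auto
qed

subsection \<open>The bound on eta\<close>

text \<open>At most \<open>card X * wcol G ord (2 * L)\<close> vertices are weakly reachable from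
  \<open>Y\<close>, so \<open>eta_le\<close> controls the subgraph \<open>H'\<close> on them. The
  least vertex of a short walk avoiding \<open>A\<close> between vertices of \<open>Y\<close> lies
  in \<open>X' - A\<close> and is equal or adjacent in \<open>H'\<close> to both ends, which are
  thus in one component.\<close>

lemma (in weighted_graph) eta_far_split:
  assumes VE: "V = pverts G" "E = parcs G" and G: "pair_graph G"
    and ord: "linear_order_on (pverts G) ord"
    and Y: "Y \<subseteq> X" "X \<subseteq> V" "card X * wcol G ord (2 * L) \<le> n"
  shows "far_split Y L (eta_le n (wreach_graph G ord (2 * L)) s) (sum \<rho> V / real s)"
proof -
  define H where "H = wreach_graph G ord (2 * L)"
  define X' where "X' = (\<Union>v\<in>Y. wreach G ord (2 * L) v)"
  define H' where "H' = induced H X'"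
  \<comment> \<open>With the cost restricted to \<open>Y\<close> as weight, balance bounds the cost
    of each class.\<close>
  define w' where "w' = (\<lambda>v. if v \<in> Y then \<rho> v else 0)"
  have H: "pair_graph H" unfolding H_def using G by (rule pair_graph_wreach_graph)
  have X'V: "X' \<subseteq> V" unfolding X'_def VE using wreach_subset[OF G] by auto
  have X'H: "X' \<subseteq> pverts H" using X'V unfolding H_def wreach_graph_def VE by auto
  have H': "pair_graph H'" "simple_subgraph H' H" "pverts H' = X'"
    unfolding H'_def using pair_graph_induced[OF H X'H] simple_subgraph_induced[OF H X'H] by auto
  have YV: "Y \<subseteq> V" using Y by auto
  have YX': "Y \<subseteq> X'" using wreach_refl[OF G ord] YV unfolding X'_def VE by auto
  have fin: "finite V" "finite X'" "finite Y" using finite_V finite_sub X'V YV by auto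
  have "card X' \<le> (\<Sum>v\<in>Y. card (wreach G ord (2 * L) v))"
    unfolding X'_def using fin by (intro card_UN_le)
  also have "\<dots> \<le> card Y * wcol G ord (2 * L)"
    using sum_bounded_above[of Y "\<lambda>v. card (wreach G ord (2 * L) v)" "wcol G ord (2 * L)"]
      card_wreach_le_wcol[OF G] YV VE by auto
  also have "\<dots> \<le> card X * wcol G ord (2 * L)"
    using Y finite_sub[OF Y(2)] by (intro mult_le_mono1 card_mono) auto
  finally have "card (pverts H') \<le> n" using Y(3) H'(3) by simp
  then have eta: "eta H' s \<le> eta_le n H s" by (rule eta_le_eta_le_subgraph[OF H H'(2)])
  have "assignment H' w'" "assignment H' \<rho>"
    unfolding assignment_def w'_def H'(3) using X'V rho_nonneg by auto
  then obtain A where A: "balanced_separator H' w' A" "cheap_with_outliers H' \<rho> s (eta H' s) A"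
    using eta_separator[OF H'(1)] by blast
  then obtain Z where Z: "Z \<subseteq> A" "card Z \<le> eta H' s" "sum \<rho> (A - Z) \<le> sum \<rho> X' / real s"
    unfolding cheap_with_outliers_def H'(3) by auto
  have AX': "A \<subseteq> X'" using A(1) unfolding balanced_separator_def H'(3) by auto
  have cheap: "sum \<rho> (A - Z) \<le> sum \<rho> V / real s"
    using Z(3) divide_right_mono[OF sum_rho_mono[OF X'V order.refl], of "real s"] by simp
  define D where "D = with_proj H' \<restriction> (X' - A)"
  interpret H': pair_graph H' by (rule H')
  have "induced_subgraph D (with_proj H')"
    unfolding D_def by (rule H'.induced_induce) (use H'(3) in auto)
  then interpret D: sym_digraph D by (rule H'.induced_graph_imp_graph)
  have vD: "verts D = X' - A" unfolding D_def by simp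
  define comp where "comp u = {v. reachable D u v}" for u
  have comp_sub: "comp u \<subseteq> X' - A" for u unfolding comp_def using D.reachable_in_verts vD by auto
  have comp_eq: "comp u = comp v" if "v \<in> comp u" for u v
    using that D.reachable_trans D.symmetric_reachable' unfolding comp_def by blast
  have comp_refl: "u \<in> comp u" if "u \<in> X' - A" for u unfolding comp_def using that vD by auto
  define \<Q> where "\<Q> = (\<lambda>u. comp u \<inter> Y) ` (Y - A)"
  have "finite \<Q>" unfolding \<Q>_def using fin by auto
  moreover have "disjoint \<Q>"
    unfolding \<Q>_def
  proof (rule disjointI)
    fix P Q assume PQ: "P \<in> (\<lambda>u. comp u \<inter> Y) ` (Y - A)" "Q \<in> (\<lambda>u. comp u \<inter> Y) ` (Y - A)" "P \<noteq> Q"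
    show "P \<inter> Q = {}"
    proof (rule ccontr)
      assume "P \<inter> Q \<noteq> {}"
      then show False using PQ comp_eq by blast
    qed
  qed
  moreover have "\<Union>\<Q> = Y - A" unfolding \<Q>_def using comp_sub comp_refl YX' by blast
  moreover have "sum \<rho> Q \<le> 2/3 * sum \<rho> Y" if "Q \<in> \<Q>" for Q
  proof -
    from that obtain u where u: "u \<in> Y - A" "Q = comp u \<inter> Y" unfolding \<Q>_def by auto
    have "pre_digraph.max_subgraph D Digraph_Component.connected (D \<restriction> comp u)"
      unfolding comp_def using u YX' vD by (intro connected_component_max_subgraph D.sym_digraph_axioms) auto
    then have "sum w' (comp u) \<le> 2 / 3 * sum w' X'"
      using A(1) unfolding balanced_separator_def D_def H'(3) by force
    moreover have "sum w' (comp u) = sum \<rho> Q"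
      unfolding u w'_def using comp_sub[of u] fin finite_subset by (subst sum.inter_restrict) auto
    moreover have "sum w' X' = sum \<rho> Y"
      unfolding w'_def using YX' fin by (subst sum.inter_restrict[symmetric]) (auto simp: Int_absorb1)
    ultimately show ?thesis by simp
  qed
  moreover have "(x, y) \<notin> (Restr E (V - A)) ^^ k"
    if "P \<in> \<Q>" "Q \<in> \<Q>" "P \<noteq> Q" "x \<in> P" "y \<in> Q" "k \<le> 2 * L" for P Q x y k
  proof
    assume walk: "(x, y) \<in> (Restr E (V - A)) ^^ k"
    obtain u where u: "P = comp u \<inter> Y" using \<open>P \<in> \<Q>\<close> unfolding \<Q>_def by auto
    obtain v where v: "Q = comp v \<inter> Y" using \<open>Q \<in> \<Q>\<close> unfolding \<Q>_def by auto
    have xy: "x \<in> Y" "y \<in> Y" "x \<in> X' - A" "y \<in> X' - A" "x \<in> V - A"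
      using u v that comp_sub X'V by blast+
    then obtain z where z: "z \<in> V - A" "z \<in> wreach G ord (2 * L) x" "z \<in> wreach G ord (2 * L) y"
      using short_walk_common_wreach[OF G ord, of x y k "V - A" "2 * L"] walk \<open>k \<le> 2 * L\<close> VE by auto
    have zX': "z \<in> X' - A" using z xy unfolding X'_def by auto
    have "reachable D a z" if a: "a \<in> Y" "a \<in> X' - A" "z \<in> wreach G ord (2 * L) a" for a
    proof (cases "a = z")
      case True
      then show ?thesis using zX' vD by auto
    next
      case False
      then have "(a, z) \<in> parcs H" unfolding H_def wreach_graph_def using a zX' X'V VE by auto
      then have "(a, z) \<in> arcs D" using a zX' unfolding D_def H'_def by auto
      then have "(a, z) \<in> arcs_ends D" using D.in_arcs_imp_in_arcs_ends[of "(a, z)"] unfolding D_def by simp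
      then show ?thesis by (rule D.reachable_adjI)
    qed
    then have "z \<in> comp x" "z \<in> comp y" using z xy unfolding comp_def by auto
    then have "comp x = comp y" using comp_eq by blast
    then have "comp u = comp v" using comp_eq[of x u] comp_eq[of y v] u v that by auto
    then show False using u v \<open>P \<noteq> Q\<close> by simp
  qed
  ultimately show ?thesis
    unfolding far_split_def H_def[symmetric]
    using AX' X'V Z(1,2) eta cheap
    by (intro exI[of _ A] exI[of _ Z] exI[of _ \<Q>]) (auto intro: order.trans)
qed

section \<open>Choice of the parameters\<close>

lemma ell_gt: "0 < s \<Longrightarrow> (1 + 1 / real s) ^ ell s b > real b"
  unfolding ell_def by (rule LeastI_ex) (rule real_arch_pow, simp)

lemma ell_pos: "0 < s \<Longrightarrow> 0 < b \<Longrightarrow> 0 < ell s b"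
  using ell_gt[of s b] by (cases "ell s b") auto

theorem theorem12:
  fixes G :: "'a pair_pre_digraph" and ord :: "'a rel" and n t l b m r n' :: nat
  assumes "pair_graph G"
    and "n = card (pverts G)"
    and "linear_order_on (pverts G) ord"
    and "t \<ge> 1"
    and "l = 2 * ell (5 * t) (5 * t * n)"
    and "b = (omega l G)\<^sup>2 * l"
    and "m = 2 * ell (5 * t) (20 * t)"
    and "r = nat \<lceil>log (9/8) (20 * real t / 3)\<rceil>"
    and "n' = 5 * b * t * wcol G ord m"
  shows "eta G t \<le> r * eta_le n' (wreach_graph G ord m) (5 * r * t)"
proof -
  define q where "q = eta_le n' (wreach_graph G ord m) (5 * r * t)"
  have "\<exists>C. balanced_separator G w C \<and> cheap_with_outliers G \<rho> t (r * q) C"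
    if asg: "assignment G w" "assignment G \<rho>" for w \<rho>
  proof -
    note G = pair_graphD[OF assms(1)]
    interpret weighted_graph "pverts G" "parcs G" w \<rho>
      using G asg by unfold_locales (auto simp: assignment_def)
    define R where "R = sum \<rho> (pverts G)"
    have R: "0 \<le> R" unfolding R_def by (rule sum_rho_nonneg) simp
    note balanced = separates_imp_balanced_separator[OF refl refl assms(1)]
    \<comment> \<open>The main case needs positive cost and weight. With zero cost everything can be
      deleted; with zero weight nothing has to be.\<close>
    consider "R = 0" | "sum w (pverts G) = 0" | "0 < R" "0 < sum w (pverts G)"
      using R sum_w_nonneg[of "pverts G"] by fastforce
    then show ?thesis
    proof cases
      case 1
      have "sum w U \<le> 2/3 * sum w (pverts G)" if "U \<subseteq> pverts G - pverts G" for U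
        using that sum_w_nonneg[of "pverts G"] by auto
      then have "balanced_separator G w (pverts G)" by (intro balanced) (auto simp: separates_def)
      moreover have "cheap_with_outliers G \<rho> t (r * q) (pverts G)"
        using 1 unfolding cheap_with_outliers_def R_def by (intro exI[of _ "{}"]) auto
      ultimately show ?thesis by blast
    next
      case 2
      have "sum w U \<le> 2/3 * sum w (pverts G)" if "U \<subseteq> pverts G" for U
        using that sum_w_mono[of U "pverts G"] 2 by auto
      then have "balanced_separator G w {}" by (intro balanced) (auto simp: separates_def)
      moreover have "cheap_with_outliers G \<rho> t (r * q) {}"
        using R unfolding cheap_with_outliers_def R_def by auto
      ultimately show ?thesis by blast
    next
      case 3
      define L where "L = ell (5 * t) (20 * t)"
      define M where "M = ell (5 * t) (5 * t * n)"
      define T where "T = 5 * real t"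
      \<comment> \<open>\<open>4 * u\<close> is a fifth of the budget \<open>R / t\<close>, and the
        \<open>20 * t\<close> in \<open>L\<close> lets a ball of cost \<open>u\<close> outgrow
        \<open>R\<close>.\<close>
      define u where "u = R / (20 * real t)"
      \<comment> \<open>At most \<open>5 * b * t\<close> vertices cost more than \<open>c\<close>,
        while \<open>b\<close> vertices of cost at most \<open>c\<close> take at most a fifth of the
        budget.\<close>
      define c where "c = R / (5 * real b * real t)"
      define X where "X = {v \<in> pverts G. \<rho> v > c}"
      have t: "0 < real t" using assms(4) by simp
      have ne: "pverts G \<noteq> {}" using 3(1) unfolding R_def by auto
      then have n: "0 < n" using assms(2) G(1) by (simp add: card_gt_0_iff)
      have T: "0 < T" using t unfolding T_def by simp
      have u: "0 < u" using 3(1) t unfolding u_def by simp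
      have L: "(1 + 1 / T) ^ L > 20 * real t" using ell_gt[of "5 * t" "20 * t"] t unfolding L_def T_def by simp
      have M: "(1 + 1 / T) ^ M > 5 * real t * real n"
        using ell_gt[of "5 * t" "5 * t * n"] t unfolding M_def T_def by simp
      have "0 < M" unfolding M_def using assms(4) n by (intro ell_pos) auto
      have l: "l = 2 * M" using assms(5) unfolding M_def by simp
      have m: "m = 2 * L" using assms(7) unfolding L_def by simp
      have grow: "(1 + 1 / T) ^ L * u > R"
        using mult_strict_right_mono[OF L u] t unfolding u_def by simp
      \<comment> \<open>Positivity of \<open>r\<close> lets it cancel in
        \<open>r * (R / (5 * r * t))\<close>.\<close>
      have "log (9/8) (20 * real t / 3) > 0" using assms(4) by (subst zero_less_log_cancel_iff) auto
      then have r: "0 < r" "log (9/8) (20 * real t / 3) \<le> real r" unfolding assms(8) by linarith+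
      \<comment> \<open>The choice of \<open>r\<close> makes \<open>(8/9) ^ r\<close> at most
        \<open>3 / (20 * t)\<close>, and \<open>3 * u\<close> is this fraction of
        \<open>R\<close>.\<close>
      have "20 * real t / 3 = (9/8) powr (log (9/8) (20 * real t / 3))" using t by simp
      also have "\<dots> \<le> (9/8) powr (real r)" using r(2) by (intro powr_mono) auto
      also have "\<dots> = (9/8) ^ r" by (simp add: powr_realpow)
      finally have "(8/9) ^ r * (20 * real t / 3) \<le> (8/9) ^ r * (9/8) ^ r"
        by (intro mult_left_mono) auto
      also have "\<dots> = (1::real)" by (simp add: power_mult_distrib[symmetric])
      finally have "(8/9) ^ r * (20 * real t / 3) * (3 * u) \<le> 1 * (3 * u)"
        using u by (intro mult_right_mono) auto
      then have shrink: "(8/9) ^ r * R \<le> 3 * u" using t unfolding u_def by (simp add: mult.commute)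
      obtain v where v: "v \<in> pverts G" using ne by auto
      \<comment> \<open>A bag with a single vertex shows that \<open>omega l G\<close> is positive.
        Hence so is \<open>b\<close>, and the division by \<open>b\<close> in \<open>c\<close> is
        genuine.\<close>
      have "\<exists>k\<le>l. (v, v) \<in> (Restr (parcs G) {v}) ^^ k" by (intro exI[of _ 0]) auto
      then have "shallow_clique (parcs G) l {{v}}" unfolding shallow_clique_def by auto
      then have "card {{v}} \<le> omega l G" using v by (intro card_shallow_clique_le_omega[OF assms(1)]) auto
      then have b: "0 < real b" using assms(6) l \<open>0 < M\<close> by simp
      then have c: "0 < c" unfolding c_def using 3(1) t by simp
      have X: "X \<subseteq> pverts G" unfolding X_def by auto
      have "real (card X) * c \<le> sum \<rho> X" using sum_bounded_below[of X c \<rho>] unfolding X_def by auto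
      also have "\<dots> \<le> R" unfolding R_def using X by (intro sum_rho_mono) auto
      also have "R = real (5 * b * t) * c" unfolding c_def using b t by simp
      finally have "card X \<le> 5 * b * t" using c by (simp only: mult_le_cancel_right_pos of_nat_le_iff)
      then have cardX: "card X * wcol G ord (2 * L) \<le> n'" unfolding assms(9) m by (rule mult_le_mono1)
      \<comment> \<open>By the choice of \<open>M\<close>, a vertex too cheap for ball growing costs
        at most \<open>R / (5 * t * n)\<close>; all of them together cost at most a fifth of the
        budget.\<close>
      have low: "sum \<rho> {v \<in> pverts G. (1 + 1/T) ^ M * \<rho> v \<le> sum \<rho> (pverts G)} \<le> R / (5 * real t)"
      proof -
        let ?A = "{v \<in> pverts G. (1 + 1/T) ^ M * \<rho> v \<le> sum \<rho> (pverts G)}"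
        have "\<rho> v \<le> R / (5 * real t * real n)" if "v \<in> ?A" for v
        proof -
          have "5 * real t * real n * \<rho> v \<le> (1 + 1/T) ^ M * \<rho> v"
            using M that rho_nonneg by (intro mult_right_mono) auto
          also have "\<dots> \<le> R" using that unfolding R_def by simp
          finally show ?thesis using t n by (simp add: field_simps)
        qed
        then have "sum \<rho> ?A \<le> real (card ?A) * (R / (5 * real t * real n))"
          by (rule sum_bounded_above)
        also have "\<dots> \<le> real n * (R / (5 * real t * real n))"
          using R t unfolding assms(2) by (intro mult_right_mono of_nat_mono card_mono G(1)) auto
        also have "\<dots> = R / (5 * real t)" using n by simp
        finally show ?thesis .
      qed
      have "\<exists>C Z. C \<subseteq> pverts G \<and> Z \<subseteq> C \<and> card Z \<le> r * q \<and> separates C \<and>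
        sum \<rho> (C - Z) \<le> real r * (R / real (5 * r * t)) + R / T + 4 * u + R / (5 * real t)
          + real ((omega l G)\<^sup>2 * l) * c"
      proof (rule separator_from_far_splits[OF T u, folded R_def, OF grow shrink X])
        show "far_split Y L q (R / real (5 * r * t))" if "Y \<subseteq> X" for Y
          unfolding q_def m R_def
          by (rule eta_far_split[OF refl refl assms(1,3) that X cardX])
        show "\<rho> v \<le> c" if "v \<in> pverts G - X" for v using that unfolding X_def by auto
        show "card \<B> \<le> omega l G"
          if "shallow_clique (parcs G) l \<B>" "finite \<B>" "\<Union>\<B> \<subseteq> pverts G" for \<B>
          using that by (rule card_shallow_clique_le_omega[OF assms(1)])
      qed (use 3 R c l \<open>0 < M\<close> low in \<open>auto simp: R_def\<close>)
      then obtain C Z where C: "C \<subseteq> pverts G" "Z \<subseteq> C" "card Z \<le> r * q" "separates C"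
        "sum \<rho> (C - Z) \<le> real r * (R / real (5 * r * t)) + R / T + 4 * u + R / (5 * real t)
          + real ((omega l G)\<^sup>2 * l) * c" by blast
      \<comment> \<open>each of the five kinds of deleted vertices costs at most \<open>R / (5t)\<close>\<close>
      have "real r * (R / real (5 * r * t)) = R / (5 * real t)" using r by simp
      moreover have "real ((omega l G)\<^sup>2 * l) * c = R / (5 * real t)"
        unfolding assms(6)[symmetric] c_def using b by simp
      moreover have "R / T = R / (5 * real t)" "4 * u = R / (5 * real t)" unfolding T_def u_def by auto
      moreover have "5 * (R / (5 * real t)) = R / real t" using t by simp
      ultimately have "sum \<rho> (C - Z) \<le> R / real t" using C(5) by linarith
      then have "cheap_with_outliers G \<rho> t (r * q) C"
        unfolding cheap_with_outliers_def using C R_def by blast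
      then show ?thesis using balanced[OF C(1,4)] by blast
    qed
  qed
  then have "eta G t \<le> r * q" unfolding eta_def by (intro Least_le) blast
  then show ?thesis unfolding q_def .
qed

end
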